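(* Assume that $G$ is a finite non-nilpotent group that can be decomposed as a direct product of non-trivial factors. If $P^*(G)$ is claw-free, then there exist two distinct primes $p$ and $q$ such that $G=H\times K$, where $H\cong C_p$ and $K$ is the semidirect product of a cyclic $q$-group $Q$ and a cyclic $p$-subgroup $P$ of $\mathrm{Aut}(Q)$. Moreover, either $P\cong C_p$, or $p=2$ and $P\cong C_4$.
   Context: For a group $G$, the power graph $P(G)$ is the simple undirected graph whose vertices are the elements of $G$, two distinct vertices $u,v$ being adjacent if and only if one of them is a power of the other (equivalently, one of $\langle u\rangle,\langle v\rangle$ is contained in the other). The reduced power graph $P^*(G)$ is the subgraph of $P(G)$ induced by the non-identity elements. A graph is claw-free if it has no induced subgraph isomorphic to the complete bipartite graph $K_{1,3}$. $C_n$ denotes the cyclic group of order $n$. In the semidirect product $K=Q\rtimes P$, the normal factor is $Q$ and $P\leq\mathrm{Aut}(Q)$ acts naturally on $Q$. *)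

theory Defs
  imports
    "HOL-Computational_Algebra.Primes"
    "HOL-Algebra.Bij"
    "HOL-Algebra.Elementary_Groups"
    "HOL-Algebra.Generated_Groups"
    "Graph_Theory.Graph_Theory"
    "Graph_Theory.Kuratowski"
begin

section \<open>Power graphs and claws\<close>

text \<open>An undirected simple graph is represented, as in the AFP graph library, by a loop-free
  symmetric digraph whose arcs are the pairs of adjacent vertices.\<close>

definition power_graph :: "('a, 'b) monoid_scheme \<Rightarrow> ('a, 'a \<times> 'a) pre_digraph" where
  "power_graph G = with_proj
     \<lparr> pverts = carrier G,
       parcs = {(u, v). u \<in> carrier G \<and> v \<in> carrier G \<and> u \<noteq> v \<and>
                  ((\<exists>k::int. u = v [^]\<^bsub>G\<^esub> k) \<or> (\<exists>k::int. v = u [^]\<^bsub>G\<^esub> k))} \<rparr>"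

definition reduced_power_graph :: "('a, 'b) monoid_scheme \<Rightarrow> ('a, 'a \<times> 'a) pre_digraph" where
  "reduced_power_graph G = power_graph G \<restriction> (carrier G - {\<one>\<^bsub>G\<^esub>})"

text \<open>The library predicate \<open>K\<^bsub>1,3\<^esub>\<close> holds of every graph that is isomorphic to the claw, so no
  explicit isomorphism is needed.\<close>

definition claw_free :: "('a, 'b) pre_digraph \<Rightarrow> bool" where
  "claw_free \<Gamma> \<longleftrightarrow> \<not> (\<exists>H. induced_subgraph H \<Gamma> \<and> K\<^bsub>1,3\<^esub> H)"

section \<open>Nilpotent groups, direct and semidirect products\<close>

text \<open>The terms of the lower central series, starting with the whole group at index 0.\<close>

primrec lower_central :: "('a, 'b) monoid_scheme \<Rightarrow> nat \<Rightarrow> 'a set" where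
  "lower_central G 0 = carrier G"
| "lower_central G (Suc n) =
     generate G (\<Union>x \<in> lower_central G n. \<Union>y \<in> carrier G.
       {x \<otimes>\<^bsub>G\<^esub> y \<otimes>\<^bsub>G\<^esub> inv\<^bsub>G\<^esub> x \<otimes>\<^bsub>G\<^esub> inv\<^bsub>G\<^esub> y})"

definition nilpotent_group :: "('a, 'b) monoid_scheme \<Rightarrow> bool" where
  "nilpotent_group G \<longleftrightarrow> group G \<and> (\<exists>n. lower_central G n = {\<one>\<^bsub>G\<^esub>})"

definition internal_direct_product ::
    "('a, 'b) monoid_scheme \<Rightarrow> 'a set \<Rightarrow> 'a set \<Rightarrow> bool" where
  "internal_direct_product G A B \<longleftrightarrow>
     A \<lhd> G \<and> B \<lhd> G \<and> A \<inter> B = {\<one>\<^bsub>G\<^esub>} \<and> A <#>\<^bsub>G\<^esub> B = carrier G"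

text \<open>\<open>P\<close> is the carrier of a subgroup of \<open>AutoGroup Q\<close>, acting on \<open>Q\<close> by evaluation.\<close>

definition semidirect_product ::
    "('a, 'b) monoid_scheme \<Rightarrow> ('a \<Rightarrow> 'a) set \<Rightarrow> ('a \<times> ('a \<Rightarrow> 'a)) monoid" where
  "semidirect_product Q P =
     \<lparr> carrier = carrier Q \<times> P,
       mult = (\<lambda>(x, \<alpha>) (y, \<beta>). (x \<otimes>\<^bsub>Q\<^esub> \<alpha> y, \<alpha> \<otimes>\<^bsub>AutoGroup Q\<^esub> \<beta>)),
       one = (\<one>\<^bsub>Q\<^esub>, \<one>\<^bsub>AutoGroup Q\<^esub>) \<rparr>"

definition is_p_group :: "nat \<Rightarrow> ('a, 'b) monoid_scheme \<Rightarrow> bool" where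
  "is_p_group p G \<longleftrightarrow> group G \<and> (\<exists>n. order G = p ^ n)"

end

theory Submission
  imports
    Defs
    "HOL-Algebra.Group_Action"
    "HOL-Algebra.Sylow"
    "HOL-Number_Theory.Residues"
begin

text \<open>In a claw-free reduced power graph a nontrivial element lies in at most two pairwise incomparable
  cyclic subgroups (\<open>no_three_above\<close>), and a cyclic subgroup contains at most two pairwise
  incomparable ones (\<open>no_three_below\<close>). If \<open>x\<close> commutes with \<open>z\<close> and has order coprime to it, then
  \<open>z \<otimes> x\<close> generates a cyclic subgroup above both; so the first restriction passes to the elements
  of coprime order that centralize \<open>z\<close>. Consequently a subgroup consisting of such elements is
  cyclic (\<open>coprime_centralizing_subgroup_cyclic\<close>), and for each prime not dividing the order of
  \<open>z\<close> at most one subgroup of that order centralizes \<open>z\<close>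
  (\<open>unique_coprime_prime_order_subgroup\<close>).

  In a direct product \<open>A \<times> B\<close> the elements of one factor centralize the other factor. If only one prime
  divides the group order, the group is nilpotent. Otherwise there are distinct primes, one occurring in
  each factor; uniqueness of subgroups of prime order shows that a third prime would produce an element
  of order a product of three primes, and that the two primes cannot both occur in both factors. If
  neither occurs twice, both factors are cyclic and the group is abelian. So in the non-nilpotent case,
  up to exchanging the factors, \<open>B\<close> is a \<open>p\<close>-group and \<open>A\<close> has elements of orders \<open>p\<close> and \<open>q\<close>.

  Let \<open>y \<in> A\<close> have order \<open>q\<close> and \<open>z \<in> B\<close> have order \<open>p\<close>. The centralizer \<open>Q\<close> of \<open>y\<close> in \<open>A\<close> contains no
  element of order \<open>p\<close>, since \<open>z\<close> is already there; hence it is a \<open>q\<close>-group, and it is cyclic because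
  it centralizes \<open>z\<close>. The subgroup generated by \<open>y\<close> is normal in \<open>A\<close>, so \<open>A\<close> modulo \<open>Q\<close> embeds
  in the cyclic group of units modulo \<open>q\<close>, and \<open>A\<close> is the product of \<open>Q\<close> and the cyclic group of a
  \<open>p\<close>-element \<open>g\<close>, which acts faithfully on \<open>Q\<close>. Finally, products of elements of the two factors
  give incomparable cyclic subgroups above a power of a generator of \<open>B\<close>, or of \<open>g\<close>, unless \<open>B\<close> has
  order \<open>p\<close> and \<open>g\<close> has order \<open>p\<close>, or \<open>4\<close> when \<open>p = 2\<close>.\<close>

section \<open>Conjugation\<close>

context group
begin

lemma inv_mult_cancel:
  assumes "x \<in> carrier G" "y \<in> carrier G"
  shows "inv x \<otimes> (x \<otimes> y) = y" "x \<otimes> (inv x \<otimes> y) = y"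
  using assms by (simp_all add: m_assoc[symmetric])

lemma conj_mult:
  assumes "g \<in> carrier G" "x \<in> carrier G" "y \<in> carrier G"
  shows "g \<otimes> (x \<otimes> y) \<otimes> inv g = (g \<otimes> x \<otimes> inv g) \<otimes> (g \<otimes> y \<otimes> inv g)"
  using assms by (simp add: m_assoc inv_mult_cancel)

lemma conj_pow:
  assumes "g \<in> carrier G" "x \<in> carrier G"
  shows "(g \<otimes> x \<otimes> inv g) [^] (n :: nat) = g \<otimes> x [^] n \<otimes> inv g"
  using assms by (induction n) (simp_all add: conj_mult)

lemma conj_eq_one_iff:
  assumes "g \<in> carrier G" "x \<in> carrier G"
  shows "g \<otimes> x \<otimes> inv g = \<one> \<longleftrightarrow> x = \<one>"
  using assms inv_solve_right'[of \<one> "g \<otimes> x" g] by simp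

lemma conj_eq_iff_commute:
  assumes "g \<in> carrier G" "x \<in> carrier G"
  shows "g \<otimes> x \<otimes> inv g = x \<longleftrightarrow> g \<otimes> x = x \<otimes> g"
  using assms inv_solve_right'[of x "g \<otimes> x" g] by auto

lemma ord_conj:
  assumes "g \<in> carrier G" "x \<in> carrier G"
  shows "ord (g \<otimes> x \<otimes> inv g) = ord x"
  using assms by (subst ord_unique) (simp_all add: conj_pow conj_eq_one_iff pow_eq_id)

lemma centralizes_conj:
  assumes "z \<in> carrier G" "x \<in> carrier G" "g \<in> carrier G"
    and "z \<otimes> x = x \<otimes> z" "z \<otimes> g = g \<otimes> z"
  shows "z \<otimes> (g \<otimes> x \<otimes> inv g) = (g \<otimes> x \<otimes> inv g) \<otimes> z"
proof -
  have "z \<otimes> inv g = inv g \<otimes> z"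
    using assms by (metis inv_closed inv_solve_left inv_solve_right m_assoc m_closed)
  then show ?thesis
    using assms by (metis (no_types, lifting) inv_closed m_assoc m_closed)
qed

text \<open>The commutator of two mutually normalizing subgroups lies in both of them.\<close>

lemma commute_if_normalizing:
  assumes x: "x \<in> carrier G" and y: "y \<in> carrier G"
    and normalize: "y \<otimes> x \<otimes> inv y \<in> generate G {x}" "x \<otimes> y \<otimes> inv x \<in> generate G {y}"
    and inter: "\<And>k. k \<in> generate G {x} \<Longrightarrow> k \<in> generate G {y} \<Longrightarrow> k = \<one>"
  shows "x \<otimes> y = y \<otimes> x"
proof -
  have mem: "u \<otimes> inv v \<in> generate G {w}"
    if "u \<in> generate G {w}" "v \<in> generate G {w}" "w \<in> carrier G" for u v w
    using that generate_is_subgroup[of "{w}"] by (simp add: subgroup.m_closed subgroup.m_inv_closed)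
  define k where "k = y \<otimes> x \<otimes> inv y \<otimes> inv x"
  have "k \<in> generate G {x}"
    unfolding k_def using mem normalize(1) x by (simp add: generate.incl)
  moreover have "k = y \<otimes> inv (x \<otimes> y \<otimes> inv x)"
    using x y by (simp add: k_def inv_mult_group m_assoc)
  then have "k \<in> generate G {y}"
    using mem normalize(2) y by (simp add: generate.incl)
  ultimately have "y \<otimes> x \<otimes> inv y = x"
    using inter[of k] x y by (simp add: k_def inv_solve_right')
  then show ?thesis
    using x y conj_eq_iff_commute by simp
qed

end

section \<open>Cyclic subgroups of a finite group\<close>

locale finite_group = group G for G (structure) +
  assumes finite_carrier: "finite (carrier G)"
begin

lemma in_cyclic_iff:
  assumes "y \<in> carrier G"
  shows "x \<in> generate G {y} \<longleftrightarrow> (\<exists>n::nat. x = y [^] n)"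
  using generate_pow_on_finite_carrier[OF finite_carrier assms] by auto

lemma pow_in_cyclic: "y \<in> carrier G \<Longrightarrow> y [^] (n::nat) \<in> generate G {y}"
  using in_cyclic_iff by blast

lemma self_in_cyclic: "x \<in> generate G {x}"
  by (simp add: generate.incl)

lemma cyclic_subset_iff:
  assumes "x \<in> carrier G" "y \<in> carrier G"
  shows "generate G {x} \<subseteq> generate G {y} \<longleftrightarrow> x \<in> generate G {y}"
proof
  assume "x \<in> generate G {y}"
  then show "generate G {x} \<subseteq> generate G {y}"
    using assms generate_subgroup_incl[OF _ generate_is_subgroup] by simp
qed (use self_in_cyclic in blast)

lemma cyclic_subset_subgroup:
  assumes "subgroup H G" "x \<in> H"
  shows "generate G {x} \<subseteq> H"
  using assms generate_subgroup_incl[of "{x}" H] by simp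

lemma in_cyclic_trans:
  assumes "x \<in> generate G {y}" "y \<in> generate G {z}" "z \<in> carrier G"
  shows "x \<in> generate G {z}"
proof -
  have "y \<in> carrier G"
    using assms generate_in_carrier[of "{z}" y] by simp
  then show ?thesis
    using assms cyclic_subset_iff by blast
qed

lemma finite_cyclic: "x \<in> carrier G \<Longrightarrow> finite (generate G {x})"
  using finite_carrier generate_incl[of "{x}"] finite_subset by blast

lemma cyclic_eqI:
  assumes "x \<in> generate G {y}" "y \<in> carrier G" "ord y \<le> ord x"
  shows "generate G {x} = generate G {y}"
proof -
  have x: "x \<in> carrier G"
    using assms generate_in_carrier[of "{y}" x] by simp
  have "card (generate G {y}) \<le> card (generate G {x})"
    using assms x generate_pow_card by simp
  then show ?thesis
    using assms x cyclic_subset_iff card_seteq finite_cyclic by metis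
qed

lemma pow_eq_iff_cong:
  assumes "x \<in> carrier G"
  shows "x [^] (m::nat) = x [^] (n::nat) \<longleftrightarrow> [m = n] (mod ord x)"
  using int_pow_eq[OF assms, of "int m" "int n"]
  by (simp add: int_pow_int cong_int_iff[symmetric] cong_iff_dvd_diff dvd_diff_commute)

lemma exists_max_ord:
  assumes "S \<noteq> {}" "S \<subseteq> carrier G"
  shows "\<exists>a \<in> S. \<forall>x \<in> S. ord x \<le> ord a"
proof -
  have fin: "finite (ord ` S)"
    using assms finite_carrier finite_subset by blast
  then have "Max (ord ` S) \<in> ord ` S"
    using assms by simp
  then obtain a where a: "a \<in> S" "Max (ord ` S) = ord a"
    by (rule imageE)
  then have "\<forall>x \<in> S. ord x \<le> ord a"
    using Max_ge[OF fin] by fastforce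
  then show ?thesis
    using a by blast
qed

lemma ord_dvd_of_in_cyclic:
  assumes "x \<in> generate G {y}" "y \<in> carrier G"
  shows "ord x dvd ord y"
proof -
  obtain n :: nat where n: "x = y [^] n"
    using assms in_cyclic_iff by blast
  have "x [^] ord y = (y [^] ord y) [^] n"
    using assms(2) n by (simp only: nat_pow_pow mult.commute)
  then have "x [^] ord y = \<one>"
    using assms(2) by simp
  then show ?thesis
    using assms(2) n pow_eq_id nat_pow_closed by blast
qed

lemma in_cyclic_pow_coprime:
  assumes "x \<in> carrier G" "coprime n (ord x)"
  shows "x \<in> generate G {x [^] n}"
proof -
  obtain m where "[n * m = 1] (mod ord x)"
    using assms cong_solve_coprime_nat by auto
  then have "(x [^] n) [^] m = x [^] (1::nat)"
    using assms by (simp only: nat_pow_pow pow_eq_iff_cong)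
  then show ?thesis
    using assms in_cyclic_iff[of "x [^] n" x] by (metis nat_pow_closed nat_pow_eone)
qed

lemma prime_order_in_cyclic:
  assumes "prime (ord x)" "x \<in> carrier G" "u \<in> generate G {x}" "u \<noteq> \<one>"
  shows "x \<in> generate G {u}"
proof -
  obtain n :: nat where n: "u = x [^] n"
    using assms in_cyclic_iff by blast
  have "\<not> ord x dvd n"
    using assms n pow_eq_id by blast
  then have "coprime n (ord x)"
    using assms prime_imp_coprime coprime_commute by blast
  then show ?thesis
    using assms in_cyclic_pow_coprime n by blast
qed

lemma ord_eq_prime:
  assumes "prime p" "x \<in> carrier G" "x [^] p = \<one>" "x \<noteq> \<one>"
  shows "ord x = p"
  using assms pow_eq_id ord_eq_1 prime_nat_iff by metis

text \<open>Primes dividing element orders are realised by powers; this replaces Cauchy's theorem wherever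
  an element of suitable order is already at hand.\<close>

lemma exists_power_of_prime_order:
  assumes "x \<in> carrier G" "prime p" "p dvd ord x"
  shows "\<exists>n::nat. ord (x [^] n) = p"
proof -
  have "ord x > 0"
    using ord_ge_1[OF finite_carrier] assms(1) by fastforce
  then obtain k where k: "ord x = p * k" "k \<noteq> 0"
    using assms by (auto elim!: dvdE)
  then have "ord (x [^] k) = p"
    using assms by (simp add: ord_pow)
  then show ?thesis by blast
qed

text \<open>The Chinese remainder theorem gives an exponent that is \<open>1\<close> modulo the order of \<open>x\<close> and \<open>0\<close>
  modulo that of \<open>y\<close>.\<close>

lemma coprime_part_in_cyclic:
  assumes "x \<in> carrier G" "y \<in> carrier G" "x \<otimes> y = y \<otimes> x" "coprime (ord x) (ord y)"
  shows "x \<in> generate G {x \<otimes> y}"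
proof -
  obtain n where n: "[n = 1] (mod ord x)" "[n = 0] (mod ord y)"
    using binary_chinese_remainder_nat[OF assms(4)] by blast
  have "x [^] n = x [^] (1::nat)" "y [^] n = y [^] (0::nat)"
    using assms n pow_eq_iff_cong by blast+
  then have "(x \<otimes> y) [^] n = x"
    using assms by (simp add: pow_mult_distrib)
  then show ?thesis
    using assms in_cyclic_iff[of "x \<otimes> y" x] by (metis m_closed)
qed

lemma coprime_order_inter_trivial:
  assumes "x \<in> carrier G" "y \<in> carrier G" "coprime (ord x) (ord y)"
    and "u \<in> generate G {x}" "u \<in> generate G {y}"
  shows "u = \<one>"
proof -
  have "ord u dvd 1"
    using assms ord_dvd_of_in_cyclic by (metis coprime_common_divisor_nat dvd_1_left)
  then show ?thesis
    using assms generate_in_carrier[of "{x}" u] ord_eq_1 by simp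
qed

end

section \<open>Forbidden configurations in a claw-free reduced power graph\<close>

lemma reduced_power_graph_eq:
  assumes "group G"
  shows "reduced_power_graph G = with_proj
    \<lparr> pverts = carrier G - {\<one>\<^bsub>G\<^esub>},
      parcs = {(u, v). u \<in> carrier G - {\<one>\<^bsub>G\<^esub>} \<and> v \<in> carrier G - {\<one>\<^bsub>G\<^esub>} \<and> u \<noteq> v \<and>
                 (u \<in> generate G {v} \<or> v \<in> generate G {u})} \<rparr>"
proof -
  interpret group G by fact
  show ?thesis
    by (auto simp: reduced_power_graph_def power_graph_def induce_subgraph_def with_proj_def
        generate_pow)
qed

locale claw_free_group = finite_group +
  assumes claw_free: "claw_free (reduced_power_graph G)"
begin

lemma no_claw:
  assumes vertices: "c \<in> carrier G - {\<one>}" "x \<in> carrier G - {\<one>}" "y \<in> carrier G - {\<one>}"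
      "z \<in> carrier G - {\<one>}"
    and spokes: "\<And>u. u \<in> {x, y, z} \<Longrightarrow> u \<noteq> c \<and> (u \<in> generate G {c} \<or> c \<in> generate G {u})"
    and leaves: "x \<notin> generate G {y}" "y \<notin> generate G {x}" "x \<notin> generate G {z}"
      "z \<notin> generate G {x}" "y \<notin> generate G {z}" "z \<notin> generate G {y}"
  shows False
proof -
  define K where "K = \<lparr> pverts = {c, x, y, z}, parcs = {c} \<times> {x, y, z} \<union> {x, y, z} \<times> {c} \<rparr>"
  have distinct: "x \<noteq> y" "x \<noteq> z" "y \<noteq> z"
    using leaves self_in_cyclic by blast+
  have "\<exists>U V. pverts K = U \<union> V \<and> U \<inter> V = {} \<and> card U = 1 \<and> card V = 3 \<and>
      parcs K = U \<times> V \<union> V \<times> U"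
    by (rule exI[of _ "{c}"], rule exI[of _ "{x, y, z}"]) (use spokes distinct in \<open>auto simp: K_def\<close>)
  then have "K\<^bsub>1,3\<^esub> (with_proj K)"
    by (subst complete_bipartite_digraph_pair_def) (simp add: K_def)
  moreover have "induced_subgraph (with_proj K) (reduced_power_graph G)"
  proof -
    have sub: "{c, x, y, z} \<subseteq> carrier G - {\<one>}"
      using vertices by simp
    have arcs: "(u \<in> {c, x, y, z} \<and> v \<in> {c, x, y, z} \<and> u \<noteq> v \<and>
        (u \<in> generate G {v} \<or> v \<in> generate G {u})) \<longleftrightarrow> (u, v) \<in> parcs K" for u v
    proof -
      have "\<not> (u \<in> generate G {v} \<or> v \<in> generate G {u})"
        if "u \<in> {x, y, z}" "v \<in> {x, y, z}" "u \<noteq> v"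
        using that leaves by blast
      moreover have "u \<in> {x, y, z} \<Longrightarrow> v = c \<Longrightarrow> u \<noteq> v \<and> (u \<in> generate G {v} \<or> v \<in> generate G {u})"
        "v \<in> {x, y, z} \<Longrightarrow> u = c \<Longrightarrow> u \<noteq> v \<and> (u \<in> generate G {v} \<or> v \<in> generate G {u})"
        using spokes by blast+
      ultimately show ?thesis
        unfolding K_def by (simp only: pair_pre_digraph.simps Un_iff mem_Times_iff fst_conv snd_conv insert_iff empty_iff) metis
    qed
    have parcs: "parcs K = {(u, v). u \<in> {c, x, y, z} \<and> v \<in> {c, x, y, z} \<and> u \<noteq> v \<and>
        (u \<in> generate G {v} \<or> v \<in> generate G {u})}"
      using arcs by blast
    have wf: "wf_digraph (with_proj K)"
      by unfold_locales (auto simp: K_def)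
    have "wf_digraph (reduced_power_graph G)"
      unfolding reduced_power_graph_eq[OF is_group] by unfold_locales auto
    with wf show ?thesis
      unfolding induced_subgraph_def subgraph_def reduced_power_graph_eq[OF is_group]
      using sub unfolding compatible_def by (auto simp: parcs K_def(1)[THEN arg_cong[where f = pverts]])
  qed
  ultimately show False
    using claw_free claw_free_def by blast
qed

text \<open>The elements below \<open>c\<close> in the order of cyclic subgroups are adjacent to those above it, so the
  leaves of a claw with centre \<open>c\<close> lie all above \<open>c\<close> or all below \<open>c\<close>. This leaves two forbidden
  configurations, stated here for elements that may coincide: pairwise incomparability already
  makes the leaves distinct from each other and from \<open>c\<close>.\<close>

lemma no_three_above:
  assumes "c \<noteq> \<one>" "x \<in> carrier G" "y \<in> carrier G" "z \<in> carrier G"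
    and "c \<in> generate G {x}" "c \<in> generate G {y}" "c \<in> generate G {z}"
  shows "x \<in> generate G {y} \<or> y \<in> generate G {x} \<or> x \<in> generate G {z} \<or>
         z \<in> generate G {x} \<or> y \<in> generate G {z} \<or> z \<in> generate G {y}"
proof (rule ccontr)
  assume contra: "\<not> ?thesis"
  have c: "c \<in> carrier G"
    using assms generate_in_carrier[of "{x}" c] by simp
  show False
  proof (rule no_claw[of c x y z])
    fix u
    assume "u \<in> {x, y, z}"
    then show "u \<noteq> c \<and> (u \<in> generate G {c} \<or> c \<in> generate G {u})"
      using assms contra by blast
  qed (use assms contra c generate_one in auto)
qed

lemma no_three_below:
  assumes "c \<in> carrier G" "x \<in> generate G {c}" "y \<in> generate G {c}" "z \<in> generate G {c}"
  shows "x \<in> generate G {y} \<or> y \<in> generate G {x} \<or> x \<in> generate G {z} \<or>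
         z \<in> generate G {x} \<or> y \<in> generate G {z} \<or> z \<in> generate G {y}"
proof (rule ccontr)
  assume contra: "\<not> ?thesis"
  have carrier: "x \<in> carrier G" "y \<in> carrier G" "z \<in> carrier G"
    using assms generate_in_carrier[of "{c}"] by simp_all
  have nontrivial: "x \<noteq> \<one>" "y \<noteq> \<one>" "z \<noteq> \<one>"
    using contra generate.one by metis+
  have "c \<noteq> \<one>"
    using assms nontrivial generate_one by auto
  show False
  proof (rule no_claw[of c x y z])
    fix u
    assume "u \<in> {x, y, z}"
    then show "u \<noteq> c \<and> (u \<in> generate G {c} \<or> c \<in> generate G {u})"
      using assms contra by blast
  qed (use assms contra carrier nontrivial \<open>c \<noteq> \<one>\<close> in auto)
qed

end

section \<open>Elements of order coprime to a central element\<close>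

context finite_group
begin

text \<open>A cyclic subgroup of maximal order in \<open>S\<close> and one of maximal order among those not contained in it
  cover \<open>S\<close>, since an element outside both would be incomparable to their generators. But a group is
  not the union of two proper subgroups: the product of the two generators lies in neither.\<close>

lemma cyclic_if_no_three_incomparable:
  assumes S: "subgroup S G"
    and width: "\<And>x y z. x \<in> S \<Longrightarrow> y \<in> S \<Longrightarrow> z \<in> S \<Longrightarrow>
       x \<in> generate G {y} \<or> y \<in> generate G {x} \<or> x \<in> generate G {z} \<or>
       z \<in> generate G {x} \<or> y \<in> generate G {z} \<or> z \<in> generate G {y}"
  shows "\<exists>x \<in> S. S = generate G {x}"
proof -
  have carrier: "x \<in> carrier G" if "x \<in> S" for x
    using that S subgroup.subset by blast
  have "S \<noteq> {}"
    using S subgroup.one_closed by blast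
  then obtain a where a: "a \<in> S" "\<And>x. x \<in> S \<Longrightarrow> ord x \<le> ord a"
    using exists_max_ord[of S] carrier by blast
  have "S = generate G {a}"
  proof (rule ccontr)
    assume "S \<noteq> generate G {a}"
    define T where "T = S - generate G {a}"
    have "generate G {a} \<subseteq> S"
      using S a cyclic_subset_subgroup by blast
    then have "T \<noteq> {}" "T \<subseteq> carrier G"
      using \<open>S \<noteq> generate G {a}\<close> carrier unfolding T_def by auto
    then obtain b where b: "b \<in> T" "\<And>x. x \<in> T \<Longrightarrow> ord x \<le> ord b"
      using exists_max_ord[of T] by blast
    then have bS: "b \<in> S" "b \<notin> generate G {a}"
      by (auto simp: T_def)
    have ab: "a \<notin> generate G {b}"
    proof
      assume "a \<in> generate G {b}"
      then have "generate G {a} = generate G {b}"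
        using cyclic_eqI a bS carrier by blast
      then show False
        using bS self_in_cyclic by blast
    qed
    have cover: "s \<in> generate G {a} \<or> s \<in> generate G {b}" if s: "s \<in> S" for s
    proof (rule ccontr)
      assume out: "\<not> ?thesis"
      then have "a \<in> generate G {s} \<or> b \<in> generate G {s}"
        using width[OF a(1) bS(1) s] ab bS(2) by blast
      moreover have "ord s \<le> ord b"
        using s out b by (simp add: T_def)
      ultimately have "generate G {a} = generate G {s} \<or> generate G {b} = generate G {s}"
        using cyclic_eqI[of a s] cyclic_eqI[of b s] a(2) s carrier by blast
      then show False
        using out self_in_cyclic by blast
    qed
    have sub: "subgroup (generate G {a}) G" "subgroup (generate G {b}) G"
      using a(1) bS(1) carrier generate_is_subgroup by simp_all
    have "a \<otimes> b \<in> S"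
      using subgroup.m_closed[OF S a(1) bS(1)] .
    then consider "a \<otimes> b \<in> generate G {a}" | "a \<otimes> b \<in> generate G {b}"
      using cover by blast
    then show False
    proof cases
      case 1
      then have "inv a \<otimes> (a \<otimes> b) \<in> generate G {a}"
        using sub(1) self_in_cyclic subgroup.m_closed subgroup.m_inv_closed by metis
      then show False
        using bS a(1) carrier by (simp add: m_assoc[symmetric])
    next
      case 2
      then have "a \<otimes> b \<otimes> inv b \<in> generate G {b}"
        using sub(2) self_in_cyclic subgroup.m_closed subgroup.m_inv_closed by metis
      then show False
        using bS a(1) carrier ab by (simp add: m_assoc)
    qed
  qed
  then show ?thesis
    using a(1) by blast
qed

text \<open>Multiplication by a commuting element of coprime order reflects inclusion of cyclic subgroups.
  It therefore carries incomparable subgroups to incomparable subgroups above \<open>z\<close>.\<close>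

lemma in_cyclic_of_coprime_products:
  assumes carrier: "x \<in> carrier G" "y \<in> carrier G" "z \<in> carrier G"
    and comm: "z \<otimes> x = x \<otimes> z" "z \<otimes> y = y \<otimes> z"
    and coprime: "coprime (ord z) (ord x)"
    and mem: "z \<otimes> x \<in> generate G {z \<otimes> y}"
  shows "x \<in> generate G {y}"
proof -
  have "x \<in> generate G {x \<otimes> z}"
    using coprime_part_in_cyclic carrier comm coprime coprime_commute by metis
  then have "x \<in> generate G {z \<otimes> y}"
    using mem comm(1) in_cyclic_trans carrier by simp
  then obtain n :: nat where n: "x = (z \<otimes> y) [^] n"
    using in_cyclic_iff carrier by auto
  \<comment> \<open>raising to the power \<open>ord z\<close> kills \<open>z\<close> and does not change the subgroup generated by \<open>x\<close>\<close>
  have "x [^] ord z = (z \<otimes> y) [^] (n * ord z)"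
    using carrier unfolding n by (simp add: nat_pow_pow)
  also have "\<dots> = z [^] (n * ord z) \<otimes> y [^] (n * ord z)"
    using carrier comm pow_mult_distrib by simp
  also have "z [^] (n * ord z) = \<one>"
    using carrier pow_eq_id by simp
  finally have "x [^] ord z \<in> generate G {y}"
    using carrier pow_in_cyclic by simp
  then show ?thesis
    using in_cyclic_pow_coprime[OF carrier(1) coprime] in_cyclic_trans carrier by blast
qed

end

context claw_free_group
begin

text \<open>The products of \<open>z\<close> with the three elements generate subgroups containing \<open>z\<close>, so they cannot be
  pairwise incomparable.\<close>

lemma coprime_centralizer_width:
  assumes "z \<in> carrier G" "z \<noteq> \<one>"
    and "\<And>u. u \<in> {x, y, w} \<Longrightarrow> u \<in> carrier G \<and> z \<otimes> u = u \<otimes> z \<and> coprime (ord z) (ord u)"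
  shows "x \<in> generate G {y} \<or> y \<in> generate G {x} \<or> x \<in> generate G {w} \<or>
         w \<in> generate G {x} \<or> y \<in> generate G {w} \<or> w \<in> generate G {y}"
proof -
  have above: "z \<in> generate G {z \<otimes> u}" if "u \<in> {x, y, w}" for u
    using assms that coprime_part_in_cyclic by blast
  have reduce: "u \<in> generate G {v}"
    if "u \<in> {x, y, w}" "v \<in> {x, y, w}" "z \<otimes> u \<in> generate G {z \<otimes> v}" for u v
    using in_cyclic_of_coprime_products[of u v z] assms that by blast
  have "z \<otimes> x \<in> generate G {z \<otimes> y} \<or> z \<otimes> y \<in> generate G {z \<otimes> x} \<or>
        z \<otimes> x \<in> generate G {z \<otimes> w} \<or> z \<otimes> w \<in> generate G {z \<otimes> x} \<or>
        z \<otimes> y \<in> generate G {z \<otimes> w} \<or> z \<otimes> w \<in> generate G {z \<otimes> y}"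
    using assms above by (intro no_three_above[of z]) auto
  then show ?thesis
    using reduce by blast
qed

lemma coprime_centralizing_subgroup_cyclic:
  assumes "subgroup S G" "z \<in> carrier G" "z \<noteq> \<one>"
    and "\<And>u. u \<in> S \<Longrightarrow> z \<otimes> u = u \<otimes> z \<and> coprime (ord z) (ord u)"
  shows "\<exists>x \<in> S. S = generate G {x}"
  using assms subgroup.subset[OF assms(1)]
  by (intro cyclic_if_no_three_incomparable coprime_centralizer_width[of z]) blast+

text \<open>If \<open>x\<close> and \<open>y\<close> generated different subgroups of prime order, a third one of the same order
  would centralize \<open>z\<close>: a conjugate of one by the other, unless they normalize each other. In that
  case their commutator lies in both, so that they commute and \<open>x \<otimes> y\<close> generates a third one.\<close>

lemma unique_coprime_prime_order_subgroup:
  assumes z: "z \<in> carrier G" "z \<noteq> \<one>" "coprime (ord z) q"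
    and q: "prime q"
    and x: "x \<in> carrier G" "ord x = q" "z \<otimes> x = x \<otimes> z"
    and y: "y \<in> carrier G" "ord y = q" "z \<otimes> y = y \<otimes> z"
  shows "x \<in> generate G {y}"
proof (rule ccontr)
  assume xy: "x \<notin> generate G {y}"
  have "q \<noteq> 1"
    using q by auto
  then have nontrivial: "x \<noteq> \<one>" "y \<noteq> \<one>"
    using x y ord_eq_1 by blast+
  have swap: "v \<in> generate G {u}" if "u \<in> generate G {v}" "v \<in> carrier G" "ord v = q" "u \<noteq> \<one>" for u v
    using that q prime_order_in_cyclic by blast
  have yx: "y \<notin> generate G {x}"
    using xy swap x nontrivial by blast
  have conj_normalizes: "v \<otimes> u \<otimes> inv v \<in> generate G {u}"
    if u: "u \<in> carrier G" "ord u = q" "z \<otimes> u = u \<otimes> z" "u \<notin> generate G {v}"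
      and v: "v \<in> carrier G" "ord v = q" "z \<otimes> v = v \<otimes> z" "v \<notin> generate G {u}" for u v
  proof (rule ccontr)
    define u' where "u' = v \<otimes> u \<otimes> inv v"
    assume "v \<otimes> u \<otimes> inv v \<notin> generate G {u}"
    then have out: "u' \<notin> generate G {u}"
      by (simp add: u'_def)
    have u_nontrivial: "u \<noteq> \<one>"
      using u \<open>q \<noteq> 1\<close> ord_eq_1 by blast
    have carrier: "u' \<in> carrier G"
      using u v by (simp add: u'_def)
    have u'_ord: "ord u' = q"
      using u v by (simp add: u'_def ord_conj)
    have u'_comm: "z \<otimes> u' = u' \<otimes> z"
      using u v z centralizes_conj by (simp add: u'_def)
    have out': "u \<notin> generate G {u'}" "u' \<notin> generate G {v}" "v \<notin> generate G {u'}"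
    proof -
      show "u \<notin> generate G {u'}"
        using out swap carrier u'_ord u_nontrivial by blast
      show "u' \<notin> generate G {v}"
      proof
        assume "u' \<in> generate G {v}"
        then have "inv v \<otimes> u' \<otimes> v \<in> generate G {v}"
          using v(1) self_in_cyclic generate_is_subgroup[of "{v}"]
          by (simp add: subgroup.m_closed subgroup.m_inv_closed)
        then show False
          using u v by (simp add: u'_def m_assoc[symmetric]) (simp add: m_assoc)
      qed
      moreover have "v \<noteq> \<one>"
        using v(1,2) \<open>q \<noteq> 1\<close> ord_eq_1 by blast
      ultimately show "v \<notin> generate G {u'}"
        using swap[OF _ carrier u'_ord] by blast
    qed
    have "t \<in> carrier G \<and> z \<otimes> t = t \<otimes> z \<and> coprime (ord z) (ord t)" if "t \<in> {u, v, u'}" for t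
      using that z u v carrier u'_ord u'_comm by auto
    from coprime_centralizer_width[OF z(1,2) this] show False
      using out out' u v by blast
  qed
  have normalize: "y \<otimes> x \<otimes> inv y \<in> generate G {x}" "x \<otimes> y \<otimes> inv x \<in> generate G {y}"
    using conj_normalizes x y xy yx by blast+
  have comm: "x \<otimes> y = y \<otimes> x"
  proof (rule commute_if_normalizing[OF x(1) y(1) normalize])
    fix k assume k: "k \<in> generate G {x}" "k \<in> generate G {y}"
    show "k = \<one>"
    proof (rule ccontr)
      assume "k \<noteq> \<one>"
      then have "x \<in> generate G {k}"
        using swap[OF k(1) x(1,2)] by blast
      then show False
        using in_cyclic_trans[OF _ k(2) y(1)] xy by blast
    qed
  qed
  have prod: "x \<otimes> y \<in> carrier G" "z \<otimes> (x \<otimes> y) = x \<otimes> y \<otimes> z"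
    using x y z by (simp, metis m_assoc)
  have "(x \<otimes> y) [^] q = \<one>"
    using x(1,2) y(1,2) comm pow_ord_eq_1[of x] pow_ord_eq_1[of y] by (simp add: pow_mult_distrib)
  moreover have "x \<otimes> y \<noteq> \<one>"
  proof
    assume "x \<otimes> y = \<one>"
    then have "x = inv y"
      using x(1) y(1) inv_equality by simp
    then show False
      using xy y(1) generate_m_inv_closed[of "{y}" y] self_in_cyclic by simp
  qed
  ultimately have prod_ord: "ord (x \<otimes> y) = q"
    using ord_eq_prime q prod by blast
  have out: "x \<otimes> y \<notin> generate G {x}" "x \<otimes> y \<notin> generate G {y}"
  proof -
    show "x \<otimes> y \<notin> generate G {x}"
    proof
      assume "x \<otimes> y \<in> generate G {x}"
      then have "inv x \<otimes> (x \<otimes> y) \<in> generate G {x}"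
        using x(1) self_in_cyclic generate_is_subgroup[of "{x}"]
        by (simp add: subgroup.m_closed subgroup.m_inv_closed)
      then show False
        using x y yx by (simp add: m_assoc[symmetric])
    qed
    show "x \<otimes> y \<notin> generate G {y}"
    proof
      assume "x \<otimes> y \<in> generate G {y}"
      then have "x \<otimes> y \<otimes> inv y \<in> generate G {y}"
        using y(1) self_in_cyclic generate_is_subgroup[of "{y}"]
        by (simp add: subgroup.m_closed subgroup.m_inv_closed)
      then show False
        using x y xy by (simp add: m_assoc)
    qed
  qed
  then have out': "x \<notin> generate G {x \<otimes> y}" "y \<notin> generate G {x \<otimes> y}"
    using swap[OF _ prod(1) prod_ord] nontrivial by blast+
  have "t \<in> carrier G \<and> z \<otimes> t = t \<otimes> z \<and> coprime (ord z) (ord t)" if "t \<in> {x, y, x \<otimes> y}" for t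
    using that z x y prod prod_ord by auto
  from coprime_centralizer_width[OF z(1,2) this] show False
    using out out' xy yx by blast
qed

end

section \<open>Finite groups of prime power order are nilpotent\<close>

lemma nat_prime_power_if_unique_prime_divisor:
  fixes n p :: nat
  assumes "n > 0" "\<And>r. prime r \<Longrightarrow> r dvd n \<Longrightarrow> r = p"
  shows "\<exists>k. n = p ^ k"
  using assms
proof (induction n rule: less_induct)
  case (less n)
  show ?case
  proof (cases "n = 1")
    case True
    then show ?thesis by (auto intro: exI[of _ 0])
  next
    case False
    then obtain r where "prime r" "r dvd n"
      using prime_factor_nat by blast
    then have p: "prime p" "p dvd n"
      using less.prems by blast+
    then obtain m where m: "n = p * m"
      by (auto elim: dvdE)
    have "\<exists>k. m = p ^ k"
    proof (intro less.IH)
      show "m < n" "m > 0"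
        using m less.prems(1) prime_gt_1_nat[OF p(1)] by auto
      show "r' = p" if "prime r'" "r' dvd m" for r'
        using that less.prems(2) m by simp
    qed
    then show ?thesis
      using m by (metis power_Suc)
  qed
qed

context finite_group
begin

text \<open>A Sylow subgroup for the factorization \<open>r ^ 1 * m\<close> of the group order has order \<open>r\<close>, whatever
  power of \<open>r\<close> divides \<open>m\<close>.\<close>

lemma cauchy:
  assumes "prime r" "r dvd order G"
  shows "\<exists>x \<in> carrier G. ord x = r"
proof -
  obtain m where "order G = r ^ 1 * m"
    using assms by (auto elim: dvdE)
  then obtain H where H: "subgroup H G" "card H = r"
    using sylow_thm[OF assms(1) is_group _ finite_carrier] by (metis power_one_right)
  have "H \<noteq> {\<one>}"
    using H assms(1) by auto
  then obtain x where x: "x \<in> H" "x \<noteq> \<one>"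
    using H subgroup.one_closed by blast
  then have x_carrier: "x \<in> carrier G"
    using H subgroup.subset by blast
  have "generate G {x} \<subseteq> H"
    using H x cyclic_subset_subgroup by blast
  moreover interpret H: group "G\<lparr>carrier := H\<rparr>"
    using H subgroup_imp_group by blast
  have "x [^] r = \<one>"
    using H.pow_order_eq_1[of x] x H(2) by (simp add: order_def nat_pow_consistent[symmetric])
  ultimately show ?thesis
    using ord_eq_prime assms(1) x(2) x_carrier by blast
qed

lemma order_prime_power:
  assumes "\<And>x. x \<in> carrier G \<Longrightarrow> prime (ord x) \<Longrightarrow> ord x = p"
  shows "\<exists>k. order G = p ^ k"
  using finite_carrier order_gt_0_iff_finite cauchy assms
  by (intro nat_prime_power_if_unique_prime_divisor) blast+

end

text \<open>The conjugacy classes other than \<open>{\<one>}\<close> cannot all have size divisible by \<open>p\<close>.\<close>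

lemma (in group) prime_power_order_imp_nontrivial_center:
  assumes "prime p" "order G = p ^ k" "k > 0"
  shows "\<exists>c \<in> carrier G. c \<noteq> \<one> \<and> (\<forall>x \<in> carrier G. c \<otimes> x = x \<otimes> c)"
proof (rule ccontr)
  assume contra: "\<not> ?thesis"
  define \<phi> where "\<phi> = (\<lambda>g. (\<lambda>h \<in> carrier G. g \<otimes> h \<otimes> inv g))"
  interpret group_action G "carrier G" \<phi>
    using action_by_conjugation by (simp add: \<phi>_def)
  have "p ^ k > 0"
    using assms prime_gt_0_nat by simp
  then have fin: "finite (carrier G)"
    using assms(2) order_gt_0_iff_finite by simp
  define Os where "Os = Group_Action.orbits G (carrier G) \<phi>"
  have fin_orbits: "finite Os"
    using fin orbits_coverture finite_UnionD[of Os] by (simp add: Os_def)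
  have one_orbit: "Group_Action.orbit G \<phi> \<one> = {\<one>}"
    by (auto simp: Group_Action.orbit_def \<phi>_def intro: exI[of _ \<one>])
  then have one_mem: "{\<one>} \<in> Os"
    by (force simp: Os_def Group_Action.orbits_def)
  have "p dvd card X" if X: "X \<in> Os - {{\<one>}}" for X
  proof -
    obtain x where x: "x \<in> carrier G" "X = Group_Action.orbit G \<phi> x"
      using X by (auto simp: Os_def Group_Action.orbits_def)
    then have "x \<noteq> \<one>"
      using X one_orbit by auto
    then obtain g where g: "g \<in> carrier G" "x \<otimes> g \<noteq> g \<otimes> x"
      using contra x by blast
    have "card X dvd p ^ k"
      using orbit_stabilizer_theorem[OF x(1)] x(2) assms(2) by (metis dvd_triv_left)
    then obtain j where j: "card X = p ^ j"
      using assms(1) divides_primepow_nat by blast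
    have "g \<otimes> x \<otimes> inv g \<in> X"
      using x g by (auto simp: Group_Action.orbit_def \<phi>_def)
    moreover have "x \<in> X"
      using x orbit_refl by blast
    moreover have "g \<otimes> x \<otimes> inv g \<noteq> x"
      using x g by (metis inv_solve_right' m_closed)
    ultimately have "card X \<noteq> 1"
      by (metis card_1_singletonE singletonD)
    then have "j \<noteq> 0"
      using j by auto
    then show ?thesis
      using j by simp
  qed
  then have "p dvd (\<Sum>X \<in> Os - {{\<one>}}. card X)"
    by (rule dvd_sum)
  moreover have "order G = card {\<one>} + (\<Sum>X \<in> Os - {{\<one>}}. card X)"
  proof -
    have "order G = (\<Sum>X \<in> Os. card X)"
      using disjoint_sum[OF fin, of "\<lambda>_. 1 :: nat"] by (simp add: Os_def order_def)
    then show ?thesis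
      using sum.remove[OF fin_orbits one_mem, of card] by simp
  qed
  moreover have "p dvd order G"
    using assms by simp
  ultimately have "p dvd 1"
    by (metis card.empty card_insert_disjoint dvd_add_left_iff empty_iff finite.emptyI One_nat_def)
  then show False
    using assms(1) by simp
qed

lemma (in group) lower_central_Suc_subset:
  assumes "subgroup N G"
    and "\<And>x y. x \<in> lower_central G n \<Longrightarrow> y \<in> carrier G \<Longrightarrow> x \<otimes> y \<otimes> inv x \<otimes> inv y \<in> N"
  shows "lower_central G (Suc n) \<subseteq> N"
  using assms generate_subgroup_incl[of _ N] by (simp add: UN_subset_iff)

lemma (in group) one_in_lower_central: "\<one> \<in> lower_central G n"
  by (cases n) (simp_all add: generate.one)

lemma (in group) abelian_imp_nilpotent:
  assumes "\<And>x y. x \<in> carrier G \<Longrightarrow> y \<in> carrier G \<Longrightarrow> x \<otimes> y = y \<otimes> x"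
  shows "nilpotent_group G"
proof -
  have "x \<otimes> y \<otimes> inv x \<otimes> inv y = \<one>" if "x \<in> carrier G" "y \<in> carrier G" for x y
    using assms[OF that] that by (simp add: m_assoc)
  then have "lower_central G (Suc 0) \<subseteq> {\<one>}"
    using triv_subgroup by (intro lower_central_Suc_subset) simp_all
  then show ?thesis
    using one_in_lower_central[of "Suc 0"] is_group unfolding nilpotent_group_def by blast
qed

lemma (in group) center_preimage_normal:
  assumes N: "N \<lhd> G"
  shows "{x \<in> carrier G. \<forall>y \<in> carrier G. x \<otimes> y \<otimes> inv x \<otimes> inv y \<in> N} \<lhd> G" (is "?M \<lhd> G")
proof -
  interpret N: normal N G by fact
  have conj: "g \<otimes> h \<otimes> inv g \<in> N" if "g \<in> carrier G" "h \<in> N" for g h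
    using that N.inv_op_closed2 by blast
  have "subgroup ?M G"
  proof (rule subgroupI)
    show "?M \<noteq> {}"
      by (auto intro!: exI[of _ \<one>])
  next
    fix x assume x: "x \<in> ?M"
    have "inv x \<otimes> y \<otimes> inv (inv x) \<otimes> inv y \<in> N" if y: "y \<in> carrier G" for y
    proof -
      have "inv (x \<otimes> y \<otimes> inv x \<otimes> inv y) \<in> N"
        using x y by blast
      then have "inv x \<otimes> inv (x \<otimes> y \<otimes> inv x \<otimes> inv y) \<otimes> inv (inv x) \<in> N"
        using x conj by blast
      then show ?thesis
        using x y by (simp add: inv_mult_group m_assoc)
    qed
    then show "inv x \<in> ?M"
      using x by simp
  next
    fix x x' assume x: "x \<in> ?M" and x': "x' \<in> ?M"
    have "x \<otimes> x' \<otimes> y \<otimes> inv (x \<otimes> x') \<otimes> inv y \<in> N" if y: "y \<in> carrier G" for y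
    proof -
      have "x \<otimes> (x' \<otimes> y \<otimes> inv x' \<otimes> inv y) \<otimes> inv x \<in> N"
        using x x' y conj by blast
      moreover have "x \<otimes> y \<otimes> inv x \<otimes> inv y \<in> N"
        using x y by blast
      ultimately have "x \<otimes> (x' \<otimes> y \<otimes> inv x' \<otimes> inv y) \<otimes> inv x \<otimes> (x \<otimes> y \<otimes> inv x \<otimes> inv y) \<in> N"
        by blast
      then show ?thesis
        using x x' y by (simp add: inv_mult_group m_assoc inv_mult_cancel)
    qed
    then show "x \<otimes> x' \<in> ?M"
      using x x' by simp
  qed blast
  moreover have "g \<otimes> x \<otimes> inv g \<in> ?M" if g: "g \<in> carrier G" and x: "x \<in> ?M" for g x
  proof -
    have "g \<otimes> x \<otimes> inv g \<otimes> y \<otimes> inv (g \<otimes> x \<otimes> inv g) \<otimes> inv y \<in> N" if y: "y \<in> carrier G" for y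
    proof -
      have "inv g \<otimes> y \<otimes> g \<in> carrier G"
        using g y by simp
      then have "g \<otimes> (x \<otimes> (inv g \<otimes> y \<otimes> g) \<otimes> inv x \<otimes> inv (inv g \<otimes> y \<otimes> g)) \<otimes> inv g \<in> N"
        using g x conj by blast
      then show ?thesis
        using g x y by (simp add: inv_mult_group m_assoc)
    qed
    then show ?thesis
      using g x by simp
  qed
  ultimately show ?thesis
    using normal_inv_iff by blast
qed

text \<open>A proper normal subgroup \<open>N\<close> is properly contained in the preimage of the centre of the
  quotient by \<open>N\<close>, and the lower central series moves from that preimage into \<open>N\<close> in one step. Hence
  the largest normal subgroup from which the series reaches \<open>{\<one>}\<close> is the whole group.\<close>

theorem (in finite_group) prime_power_order_imp_nilpotent:
  assumes p: "prime p" "order G = p ^ k"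
  shows "nilpotent_group G"
proof -
  define good where "good N \<longleftrightarrow> N \<lhd> G \<and>
    (\<exists>n. \<forall>m. lower_central G m \<subseteq> N \<longrightarrow> lower_central G (m + n) = {\<one>})" for N
  have "good {\<one>}"
    unfolding good_def using one_is_normal one_in_lower_central
    by (auto intro!: exI[of _ 0])
  moreover have "card N \<le> card (carrier G)" if "good N" for N
    using that card_mono[OF finite_carrier subgroup.subset[OF normal_imp_subgroup]]
    by (simp add: good_def)
  ultimately have "\<exists>N. good N \<and> (\<forall>M. good M \<longrightarrow> card M \<le> card N)"
    by (intro ex_has_greatest_nat[of good "{\<one>}" card "Suc (card (carrier G))"]) (simp_all add: le_imp_less_Suc)
  then obtain N where N: "good N" "\<And>M. good M \<Longrightarrow> card M \<le> card N"
    by metis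
  have "N = carrier G"
  proof (rule ccontr)
    assume proper: "N \<noteq> carrier G"
    interpret N: normal N G
      using N(1) by (simp add: good_def)
    have N_carrier: "N \<subseteq> carrier G"
      using N.subset .
    interpret Q: group "G Mod N"
      using N.factorgroup_is_group .
    have order_Q: "order (G Mod N) * card N = order G"
      using lagrange[OF N.subgroup_axioms] by (simp add: order_def FactGroup_def)
    then have "order (G Mod N) dvd p ^ k"
      using p by (metis dvd_triv_left)
    then obtain j where j: "order (G Mod N) = p ^ j"
      using p divides_primepow_nat by blast
    have "j \<noteq> 0"
    proof
      assume "j = 0"
      then have "card N = card (carrier G)"
        using order_Q j by (simp add: order_def)
      then show False
        using proper N_carrier finite_carrier card_subset_eq by blast
    qed
    then obtain C where C: "C \<in> carrier (G Mod N)" "C \<noteq> \<one>\<^bsub>G Mod N\<^esub>"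
      "\<And>D. D \<in> carrier (G Mod N) \<Longrightarrow> C \<otimes>\<^bsub>G Mod N\<^esub> D = D \<otimes>\<^bsub>G Mod N\<^esub> C"
      using Q.prime_power_order_imp_nontrivial_center[OF p(1) j] by blast
    then obtain x where x: "x \<in> carrier G" "C = N #> x"
      by (auto simp: FactGroup_def RCOSETS_def)
    define M where "M = {x \<in> carrier G. \<forall>y \<in> carrier G. x \<otimes> y \<otimes> inv x \<otimes> inv y \<in> N}"
    have M_normal: "M \<lhd> G"
      unfolding M_def using center_preimage_normal N.normal_axioms by blast
    have "x \<otimes> y \<otimes> inv x \<otimes> inv y \<in> N" if y: "y \<in> carrier G" for y
    proof -
      have "N #> (x \<otimes> y) = N #> (y \<otimes> x)"
        using C(3)[of "N #> y"] x y N.rcos_sum by (auto simp: FactGroup_def RCOSETS_def)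
      then have "x \<otimes> y \<in> N #> (y \<otimes> x)"
        using x y N.subgroup_axioms rcos_self by (metis m_closed)
      then obtain h where h: "h \<in> N" "x \<otimes> y = h \<otimes> (y \<otimes> x)"
        by (auto simp: r_coset_def)
      then have "x \<otimes> y \<otimes> inv (y \<otimes> x) \<in> N"
        using x y N_carrier[THEN subsetD, OF h(1)] by (simp add: inv_solve_right'[symmetric])
      then show ?thesis
        using x y by (simp add: inv_mult_group m_assoc)
    qed
    then have "x \<in> M"
      using x by (simp add: M_def)
    moreover have "x \<notin> N"
      using C(2) x N.subgroup_axioms coset_join2 by (auto simp: FactGroup_def)
    moreover have "N \<subseteq> M"
    proof
      fix h assume h: "h \<in> N"
      have "h \<otimes> y \<otimes> inv h \<otimes> inv y \<in> N" if y: "y \<in> carrier G" for y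
      proof -
        have "h \<otimes> (y \<otimes> inv h \<otimes> inv y) \<in> N"
          using h y N.inv_op_closed2 by blast
        then show ?thesis
          using h y N_carrier by (simp add: m_assoc subset_iff)
      qed
      then show "h \<in> M"
        using h N_carrier by (auto simp: M_def)
    qed
    moreover have "finite M"
      using finite_carrier by (simp add: M_def)
    ultimately have "card N < card M"
      by (metis psubsetI psubset_card_mono)
    moreover have "good M"
    proof -
      obtain n where n: "\<And>m. lower_central G m \<subseteq> N \<Longrightarrow> lower_central G (m + n) = {\<one>}"
        using N(1) unfolding good_def by blast
      have "lower_central G (m + Suc n) = {\<one>}" if m: "lower_central G m \<subseteq> M" for m
      proof -
        have "lower_central G (Suc m) \<subseteq> N"
          using N.subgroup_axioms m by (intro lower_central_Suc_subset) (auto simp: M_def)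
        then show ?thesis
          using n[of "Suc m"] by (simp del: lower_central.simps)
      qed
      then show ?thesis
        using M_normal unfolding good_def by blast
    qed
    ultimately show False
      using N(2) by fastforce
  qed
  then have "lower_central G 0 \<subseteq> N"
    by simp
  then show ?thesis
    using N(1) is_group unfolding good_def nilpotent_group_def by blast
qed

section \<open>Primes dividing the orders of the two factors\<close>

lemma (in group) internal_direct_product_sym:
  assumes "internal_direct_product G A B"
  shows "internal_direct_product G B A"
  using assms commut_normal[of B A] normal_imp_subgroup
  unfolding internal_direct_product_def by (auto simp: Int_commute)

locale claw_free_direct_product = claw_free_group +
  fixes A B
  assumes direct_product: "internal_direct_product G A B"
begin

lemma swapped: "claw_free_direct_product G B A"
  using direct_product internal_direct_product_sym by unfold_locales

lemma normal_A: "A \<lhd> G" and normal_B: "B \<lhd> G"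
  using direct_product by (simp_all add: internal_direct_product_def)

lemma subgroup_A: "subgroup A G" and subgroup_B: "subgroup B G"
  using normal_A normal_B normal_imp_subgroup by blast+

lemma A_carrier: "a \<in> A \<Longrightarrow> a \<in> carrier G" and B_carrier: "b \<in> B \<Longrightarrow> b \<in> carrier G"
  using subgroup_A subgroup_B subgroup.mem_carrier by metis+

lemma inter_trivial: "a \<in> A \<Longrightarrow> a \<in> B \<Longrightarrow> a = \<one>"
  using direct_product unfolding internal_direct_product_def by blast

lemma commute: "a \<in> A \<Longrightarrow> b \<in> B \<Longrightarrow> a \<otimes> b = b \<otimes> a"
  using normal_imp_commuting[OF normal_A normal_B] direct_product
  unfolding internal_direct_product_def by blast

lemma decompose:
  assumes "x \<in> carrier G"
  shows "\<exists>a \<in> A. \<exists>b \<in> B. x = a \<otimes> b"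
  using assms direct_product unfolding internal_direct_product_def set_mult_def by blast

lemma A_pow: "a \<in> A \<Longrightarrow> a [^] (n::nat) \<in> A" and B_pow: "b \<in> B \<Longrightarrow> b [^] (n::nat) \<in> B"
proof -
  have "x [^] n \<in> H" if "subgroup H G" "x \<in> H" for x H
    using that subgroup.one_closed[of H G] subgroup.m_closed[of H G] by (induction n) auto
  then show "a \<in> A \<Longrightarrow> a [^] (n::nat) \<in> A" "b \<in> B \<Longrightarrow> b [^] (n::nat) \<in> B"
    using subgroup_A subgroup_B by blast+
qed

lemma coordinates_unique:
  assumes "a \<in> A" "b \<in> B" "a' \<in> A" "b' \<in> B" "a \<otimes> b = a' \<otimes> b'"
  shows "a = a'" "b = b'"
proof -
  interpret group_disjoint_sum G A B
    using subgroup_A subgroup_B by (simp add: group_disjoint_sum_def is_group)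
  have "A \<inter> B \<subseteq> {\<one>}"
    using inter_trivial by blast
  then show "a = a'" "b = b'"
    using cancel assms by blast+
qed

lemma in_cyclic_coordinates:
  assumes "a \<in> A" "b \<in> B" "a' \<in> A" "b' \<in> B" "a \<otimes> b \<in> generate G {a' \<otimes> b'}"
  shows "\<exists>n::nat. a = a' [^] n \<and> b = b' [^] n"
proof -
  have carrier: "a' \<in> carrier G" "b' \<in> carrier G"
    using assms A_carrier B_carrier by blast+
  then obtain n :: nat where "a \<otimes> b = (a' \<otimes> b') [^] n"
    using assms(5) in_cyclic_iff[of "a' \<otimes> b'"] by auto
  also have "\<dots> = a' [^] n \<otimes> b' [^] n"
    using pow_mult_distrib[OF commute[OF assms(3,4)] carrier] .
  finally show ?thesis
    using coordinates_unique A_pow B_pow assms by metis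
qed

lemma conj_in_A: "g \<in> carrier G \<Longrightarrow> a \<in> A \<Longrightarrow> g \<otimes> a \<otimes> inv g \<in> A"
  using normal_A normal_inv_iff by blast

text \<open>\<open>A\<close> centralizes \<open>z\<close>, so its subgroup of order \<open>ord x\<close> is unique and hence normal.\<close>

lemma prime_subgroup_normal_in_A:
  assumes x: "x \<in> A" "prime (ord x)" and g: "g \<in> A"
    and z: "z \<in> B" "z \<noteq> \<one>" "coprime (ord z) (ord x)"
  shows "g \<otimes> x \<otimes> inv g \<in> generate G {x}"
proof -
  have carrier: "x \<in> carrier G" "g \<in> carrier G" "z \<in> carrier G"
    using x g z A_carrier B_carrier by blast+
  show ?thesis
  proof (rule unique_coprime_prime_order_subgroup[OF carrier(3) z(2,3) x(2)])
    show "g \<otimes> x \<otimes> inv g \<in> carrier G" "ord (g \<otimes> x \<otimes> inv g) = ord x"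
      using carrier ord_conj by simp_all
    show "z \<otimes> (g \<otimes> x \<otimes> inv g) = g \<otimes> x \<otimes> inv g \<otimes> z"
      using commute[OF conj_in_A[OF carrier(2) x(1)] z(1)] by simp
    show "z \<otimes> x = x \<otimes> z"
      using commute[OF x(1) z(1)] by simp
  qed (use carrier in simp_all)
qed

lemma prime_order_elements_commute:
  assumes x: "x \<in> A" "prime (ord x)" and y: "y \<in> A" "prime (ord y)" "ord x \<noteq> ord y"
    and z: "z \<in> B" "z \<noteq> \<one>" "coprime (ord z) (ord x)"
    and w: "w \<in> B" "w \<noteq> \<one>" "coprime (ord w) (ord y)"
  shows "x \<otimes> y = y \<otimes> x"
proof (rule commute_if_normalizing)
  show "x \<in> carrier G" "y \<in> carrier G"
    using x y A_carrier by blast+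
  show "y \<otimes> x \<otimes> inv y \<in> generate G {x}"
    using prime_subgroup_normal_in_A[OF x y(1) z] .
  show "x \<otimes> y \<otimes> inv x \<in> generate G {y}"
    using prime_subgroup_normal_in_A[OF y(1,2) x(1) w] .
  show "k = \<one>" if "k \<in> generate G {x}" "k \<in> generate G {y}" for k
    using coprime_order_inter_trivial[OF _ _ _ that] x y A_carrier primes_coprime by blast
qed

text \<open>The elements \<open>x\<close> and \<open>y\<close> would commute, so that \<open>x \<otimes> (y \<otimes> z)\<close> would generate a cyclic group with
  three incomparable subgroups of prime order.\<close>

lemma no_third_prime:
  assumes x: "x \<in> A" "prime (ord x)" and y: "y \<in> A" "prime (ord y)"
    and z: "z \<in> B" "prime (ord z)"
    and distinct: "ord x \<noteq> ord y" "ord z \<noteq> ord x" "ord z \<noteq> ord y"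
  shows False
proof -
  have carrier: "x \<in> carrier G" "y \<in> carrier G" "z \<in> carrier G"
    using x y z A_carrier B_carrier by blast+
  have cop: "coprime (ord x) (ord y)" "coprime (ord x) (ord z)" "coprime (ord y) (ord z)"
    using x y z distinct primes_coprime by metis+
  have z1: "z \<noteq> \<one>"
    using z ord_eq_1[OF carrier(3)] by auto
  have xy: "x \<otimes> y = y \<otimes> x"
    using prime_order_elements_commute[OF x y distinct(1) z(1) z1 _ z(1) z1] cop
    by (simp add: coprime_commute)
  have xz: "x \<otimes> z = z \<otimes> x" and yz: "y \<otimes> z = z \<otimes> y"
    using commute x y z by blast+
  have part: "u \<in> generate G {u \<otimes> (v \<otimes> w)}"
    if "u \<in> carrier G" "v \<in> carrier G" "w \<in> carrier G"
      "u \<otimes> v = v \<otimes> u" "u \<otimes> w = w \<otimes> u" "v \<otimes> w = w \<otimes> v"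
      "coprime (ord u) (ord v)" "coprime (ord u) (ord w)" for u v w
  proof (rule coprime_part_in_cyclic)
    show "coprime (ord u) (ord (v \<otimes> w))"
      using that ord_mul_divides[of v w] coprime_mult_right_iff coprime_divisors dvd_refl by metis
    show "u \<otimes> (v \<otimes> w) = v \<otimes> w \<otimes> u"
      using that by (metis m_assoc)
  qed (use that in simp_all)
  define c where "c = x \<otimes> (y \<otimes> z)"
  have c: "c \<in> carrier G" "c = y \<otimes> (x \<otimes> z)" "c = z \<otimes> (x \<otimes> y)"
    using carrier xy xz yz unfolding c_def by (simp, metis m_assoc, metis m_assoc)
  have "x \<in> generate G {c}" "y \<in> generate G {c}" "z \<in> generate G {c}"
  proof -
    show "x \<in> generate G {c}"
      unfolding c_def using part[of x y z] carrier xy xz yz cop by simp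
    show "y \<in> generate G {c}"
      unfolding c(2) using part[of y x z] carrier xy xz yz cop by (simp add: coprime_commute)
    show "z \<in> generate G {c}"
      unfolding c(3) using part[of z x y] carrier xy xz yz cop by (simp add: coprime_commute)
  qed
  moreover have "u \<notin> generate G {v}"
    if "prime (ord u)" "prime (ord v)" "ord u \<noteq> ord v" "v \<in> carrier G" for u v
    using that ord_dvd_of_in_cyclic primes_dvd_imp_eq by blast
  ultimately show False
    using no_three_below[OF c(1)] x(2) y(2) z(2) carrier distinct by metis
qed

text \<open>The elements of \<open>A\<close> of the two orders commute, so that the one of order \<open>p\<close> would centralize two
  different subgroups of order \<open>q\<close>, one in each factor.\<close>

lemma not_both_primes_in_both_factors:
  assumes x: "x \<in> A" "ord x = p" and y: "y \<in> A" "ord y = q"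
    and z: "z \<in> B" "ord z = p" and w: "w \<in> B" "ord w = q"
    and primes: "prime p" "prime q" "p \<noteq> q"
  shows False
proof -
  have carrier: "x \<in> carrier G" "y \<in> carrier G" "z \<in> carrier G" "w \<in> carrier G"
    using x y z w A_carrier B_carrier by blast+
  have nontrivial: "u \<noteq> \<one>" if "u \<in> carrier G" "prime (ord u)" for u
    using that ord_eq_1 by fastforce
  have cop: "coprime p q" "coprime q p"
    using primes primes_coprime by metis+
  have "x \<otimes> y = y \<otimes> x"
    using prime_order_elements_commute[of x y w z] x y z w primes carrier nontrivial cop by simp
  moreover have "x \<otimes> w = w \<otimes> x"
    using commute x w by blast
  ultimately have "y \<in> generate G {w}"
    using unique_coprime_prime_order_subgroup[of x q y w] x y w carrier nontrivial cop primes
    by simp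
  then have "y \<in> B"
    using cyclic_subset_subgroup[OF subgroup_B w(1)] by blast
  then show False
    using inter_trivial y nontrivial[OF carrier(2)] primes by blast
qed

end

section \<open>Semidirect products with a faithful action\<close>

lemma semidirect_product_simps [simp]:
  "carrier (semidirect_product Q P) = carrier Q \<times> P"
  "(x, \<alpha>) \<otimes>\<^bsub>semidirect_product Q P\<^esub> (y, \<beta>) = (x \<otimes>\<^bsub>Q\<^esub> \<alpha> y, \<alpha> \<otimes>\<^bsub>AutoGroup Q\<^esub> \<beta>)"
  by (simp_all add: semidirect_product_def)

context group
begin

text \<open>Elements of the automorphism group are extensional functions, which is why conjugation is
  restricted to \<open>Q\<close>.\<close>

definition conj_on :: "'a set \<Rightarrow> 'a \<Rightarrow> 'a \<Rightarrow> 'a" where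
  "conj_on Q g = (\<lambda>x \<in> Q. g \<otimes> x \<otimes> inv g)"

lemma conj_on_in_auto:
  assumes Q: "Q \<lhd> G" and g: "g \<in> carrier G"
  shows "conj_on Q g \<in> auto (G\<lparr>carrier := Q\<rparr>)"
proof -
  have sub: "x \<in> carrier G" if "x \<in> Q" for x
    using that Q normal_imp_subgroup subgroup.mem_carrier by metis
  have closed: "h \<otimes> x \<otimes> inv h \<in> Q" if "x \<in> Q" "h \<in> carrier G" for x h
    using that Q normal_inv_iff by blast
  have "bij_betw (conj_on Q g) Q Q"
  proof (rule bij_betwI[where g = "conj_on Q (inv g)"])
    show "conj_on Q g \<in> Q \<rightarrow> Q" "conj_on Q (inv g) \<in> Q \<rightarrow> Q"
      using closed[of _ g] closed[of _ "inv g"] g by (auto simp: conj_on_def)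
    show "conj_on Q (inv g) (conj_on Q g x) = x" if "x \<in> Q" for x
      using that g closed[OF that g] sub[OF that] by (simp add: conj_on_def m_assoc inv_mult_cancel)
    show "conj_on Q g (conj_on Q (inv g) x) = x" if "x \<in> Q" for x
      using that g closed[OF that inv_closed[OF g]] sub[OF that]
      by (simp add: conj_on_def m_assoc inv_mult_cancel)
  qed
  moreover have "conj_on Q g \<in> hom (G\<lparr>carrier := Q\<rparr>) (G\<lparr>carrier := Q\<rparr>)"
    using closed g sub subgroup.m_closed[OF normal_imp_subgroup[OF Q]]
    by (auto simp: hom_def conj_on_def conj_mult)
  ultimately show ?thesis
    by (simp add: auto_def Bij_def conj_on_def)
qed

lemma conj_on_mult:
  assumes Q: "Q \<lhd> G" and "g \<in> carrier G" "h \<in> carrier G"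
  shows "conj_on Q (g \<otimes> h) = conj_on Q g \<otimes>\<^bsub>AutoGroup (G\<lparr>carrier := Q\<rparr>)\<^esub> conj_on Q h"
proof -
  have sub: "x \<in> carrier G" if "x \<in> Q" for x
    using that Q normal_imp_subgroup subgroup.mem_carrier by metis
  have closed: "h \<otimes> x \<otimes> inv h \<in> Q" if "x \<in> Q" for x
    using that assms normal_inv_iff by blast
  have "conj_on Q g \<in> Bij Q" "conj_on Q h \<in> Bij Q"
    using conj_on_in_auto[OF Q] assms by (simp_all add: auto_def)
  then have "conj_on Q g \<otimes>\<^bsub>AutoGroup (G\<lparr>carrier := Q\<rparr>)\<^esub> conj_on Q h = compose Q (conj_on Q g) (conj_on Q h)"
    by (simp add: AutoGroup_def BijGroup_def)
  also have "\<dots> = conj_on Q (g \<otimes> h)"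
    using assms sub closed by (auto simp: fun_eq_iff compose_def conj_on_def inv_mult_group m_assoc)
  finally show ?thesis ..
qed

lemma conj_on_hom:
  assumes "Q \<lhd> G" "subgroup L G"
  shows "group_hom (G\<lparr>carrier := L\<rparr>) (AutoGroup (G\<lparr>carrier := Q\<rparr>)) (conj_on Q)"
proof -
  interpret Q: group "G\<lparr>carrier := Q\<rparr>"
    using assms(1) normal_imp_subgroup subgroup_imp_group by blast
  have "conj_on Q \<in> hom (G\<lparr>carrier := L\<rparr>) (AutoGroup (G\<lparr>carrier := Q\<rparr>))"
    using conj_on_in_auto[OF assms(1)] conj_on_mult[OF assms(1)] subgroup.mem_carrier[OF assms(2)]
    by (auto simp: hom_def AutoGroup_def)
  then show ?thesis
    using Q.AutoGroup subgroup_imp_group[OF assms(2)]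
    by (simp add: group_hom_def group_hom_axioms_def)
qed

text \<open>When the complement \<open>L\<close> acts faithfully on \<open>Q\<close> it can be replaced by the group of
  automorphisms of \<open>Q\<close> that it induces.\<close>

theorem faithful_complement_imp_semidirect_product:
  assumes Q: "Q \<lhd> G" and L: "subgroup L G"
    and inter: "Q \<inter> L = {\<one>}" and prod: "Q <#> L = carrier G"
    and faithful: "\<And>g. g \<in> L \<Longrightarrow> (\<And>x. x \<in> Q \<Longrightarrow> g \<otimes> x = x \<otimes> g) \<Longrightarrow> g = \<one>"
  shows "\<exists>P. subgroup P (AutoGroup (G\<lparr>carrier := Q\<rparr>)) \<and>
    G\<lparr>carrier := L\<rparr> \<cong> AutoGroup (G\<lparr>carrier := Q\<rparr>)\<lparr>carrier := P\<rparr> \<and>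
    G \<cong> semidirect_product (G\<lparr>carrier := Q\<rparr>) P"
proof -
  define P where "P = conj_on Q ` L"
  have subQ: "x \<in> carrier G" if "x \<in> Q" for x
    using that Q normal_imp_subgroup subgroup.mem_carrier by metis
  have subL: "x \<in> carrier G" if "x \<in> L" for x
    using that L subgroup.mem_carrier by metis
  interpret hom: group_hom "G\<lparr>carrier := L\<rparr>" "AutoGroup (G\<lparr>carrier := Q\<rparr>)" "conj_on Q"
    using conj_on_hom Q L by blast
  have P: "subgroup P (AutoGroup (G\<lparr>carrier := Q\<rparr>))"
    unfolding P_def using hom.img_is_subgroup by simp
  have inj: "inj_on (conj_on Q) L"
  proof -
    have "g = \<one>" if g: "g \<in> L" "conj_on Q g = \<one>\<^bsub>AutoGroup (G\<lparr>carrier := Q\<rparr>)\<^esub>" for g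
    proof (rule faithful[OF g(1)])
      fix x assume x: "x \<in> Q"
      have "conj_on Q g x = x"
        using g(2) x by (simp add: AutoGroup_def BijGroup_def)
      then show "g \<otimes> x = x \<otimes> g"
        using x subQ subL g(1) conj_eq_iff_commute by (simp add: conj_on_def)
    qed
    then have "kernel (G\<lparr>carrier := L\<rparr>) (AutoGroup (G\<lparr>carrier := Q\<rparr>)) (conj_on Q) \<subseteq> {\<one>}"
      unfolding kernel_def by (simp add: subset_iff)
    moreover have "\<one> \<in> kernel (G\<lparr>carrier := L\<rparr>) (AutoGroup (G\<lparr>carrier := Q\<rparr>)) (conj_on Q)"
      using hom.hom_one subgroup.one_closed[OF L] unfolding kernel_def by simp
    ultimately have "kernel (G\<lparr>carrier := L\<rparr>) (AutoGroup (G\<lparr>carrier := Q\<rparr>)) (conj_on Q) = {\<one>}"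
      by blast
    then show ?thesis
      using hom.inj_iff_trivial_ker by simp
  qed
  have iso_P: "G\<lparr>carrier := L\<rparr> \<cong> AutoGroup (G\<lparr>carrier := Q\<rparr>)\<lparr>carrier := P\<rparr>"
  proof (rule is_isoI, rule isoI)
    show "conj_on Q \<in> hom (G\<lparr>carrier := L\<rparr>) (AutoGroup (G\<lparr>carrier := Q\<rparr>)\<lparr>carrier := P\<rparr>)"
      using hom.homh by (auto simp: hom_def P_def)
    show "bij_betw (conj_on Q) (carrier (G\<lparr>carrier := L\<rparr>)) (carrier (AutoGroup (G\<lparr>carrier := Q\<rparr>)\<lparr>carrier := P\<rparr>))"
      using inj by (simp add: P_def bij_betw_def)
  qed
  interpret QL: group_disjoint_sum G Q L
    using L normal_imp_subgroup[OF Q] by (simp add: group_disjoint_sum_def is_group)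
  have unique: "x = x'" "l = l'"
    if "x \<in> Q" "l \<in> L" "x' \<in> Q" "l' \<in> L" "x \<otimes> l = x' \<otimes> l'" for x l x' l'
    using that QL.cancel inter by blast+
  define f where "f g = (THE r. \<exists>x \<in> Q. \<exists>l \<in> L. g = x \<otimes> l \<and> r = (x, conj_on Q l))" for g
  have f: "f (x \<otimes> l) = (x, conj_on Q l)" if xl: "x \<in> Q" "l \<in> L" for x l
    unfolding f_def
  proof (rule the_equality)
    show "\<exists>x' \<in> Q. \<exists>l' \<in> L. x \<otimes> l = x' \<otimes> l' \<and> (x, conj_on Q l) = (x', conj_on Q l')"
      using xl by blast
  next
    fix r assume "\<exists>x' \<in> Q. \<exists>l' \<in> L. x \<otimes> l = x' \<otimes> l' \<and> r = (x', conj_on Q l')"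
    then obtain x' l' where "x' \<in> Q" "l' \<in> L" "x \<otimes> l = x' \<otimes> l'" "r = (x', conj_on Q l')"
      by blast
    then show "r = (x, conj_on Q l)"
      using unique[OF xl] by simp
  qed
  have decompose: "\<exists>x \<in> Q. \<exists>l \<in> L. g = x \<otimes> l" if "g \<in> carrier G" for g
    using that prod unfolding set_mult_def by blast
  have "f \<in> hom G (semidirect_product (G\<lparr>carrier := Q\<rparr>) P)"
  proof (rule homI)
    fix g assume "g \<in> carrier G"
    then obtain x l where "x \<in> Q" "l \<in> L" "g = x \<otimes> l"
      using decompose by blast
    then show "f g \<in> carrier (semidirect_product (G\<lparr>carrier := Q\<rparr>) P)"
      by (simp add: f P_def)
  next
    fix g g' assume "g \<in> carrier G" "g' \<in> carrier G"
    then obtain x l x' l' where x: "x \<in> Q" "l \<in> L" "g = x \<otimes> l" "x' \<in> Q" "l' \<in> L" "g' = x' \<otimes> l'"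
      using decompose by meson
    have carrier: "x \<in> carrier G" "l \<in> carrier G" "x' \<in> carrier G" "l' \<in> carrier G"
      using x subQ subL by blast+
    have "l \<otimes> x' \<otimes> inv l \<in> Q"
      using Q x carrier normal_inv_iff by blast
    then have Qmem: "x \<otimes> (l \<otimes> x' \<otimes> inv l) \<in> Q"
      using x(1) subgroup.m_closed[OF normal_imp_subgroup[OF Q]] by blast
    have "g \<otimes> g' = x \<otimes> (l \<otimes> x' \<otimes> inv l) \<otimes> (l \<otimes> l')"
      using x carrier by (simp add: m_assoc inv_mult_cancel)
    then have "f (g \<otimes> g') = (x \<otimes> (l \<otimes> x' \<otimes> inv l), conj_on Q (l \<otimes> l'))"
      using f[OF Qmem subgroup.m_closed[OF L x(2) x(5)]] by simp
    also have "\<dots> = f g \<otimes>\<^bsub>semidirect_product (G\<lparr>carrier := Q\<rparr>) P\<^esub> f g'"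
      using x carrier by (simp add: f conj_on_mult[OF Q]) (simp add: conj_on_def)
    finally show "f (g \<otimes> g') = f g \<otimes>\<^bsub>semidirect_product (G\<lparr>carrier := Q\<rparr>) P\<^esub> f g'" .
  qed
  moreover have "bij_betw f (carrier G) (Q \<times> P)"
  proof (rule bij_betw_imageI)
    show "inj_on f (carrier G)"
    proof (rule inj_onI)
      fix g g' assume g: "g \<in> carrier G" "g' \<in> carrier G" "f g = f g'"
      then obtain x l x' l' where x: "x \<in> Q" "l \<in> L" "g = x \<otimes> l" "x' \<in> Q" "l' \<in> L" "g' = x' \<otimes> l'"
        using decompose by meson
      then show "g = g'"
        using g(3) inj by (simp add: f inj_on_eq_iff)
    qed
    have "(x, conj_on Q l) \<in> f ` carrier G" if "x \<in> Q" "l \<in> L" for x l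
      using that f[OF that] subQ subL by (metis image_eqI m_closed)
    moreover have "f g \<in> Q \<times> P" if "g \<in> carrier G" for g
      using decompose[OF that] f by (auto simp: P_def)
    ultimately show "f ` carrier G = Q \<times> P"
      unfolding P_def by blast
  qed
  ultimately have "G \<cong> semidirect_product (G\<lparr>carrier := Q\<rparr>) P"
    by (intro is_isoI isoI) simp_all
  then show ?thesis
    using P iso_P by blast
qed

end

section \<open>A factor of prime power order and a factor with two primes\<close>

lemma (in finite_group) coprime_ord_if_no_prime_power_element:
  assumes x: "x \<in> carrier G" and p: "prime p" and none: "\<And>n::nat. ord (x [^] n) \<noteq> p"
  shows "coprime (ord x) p"
proof -
  have "\<not> p dvd ord x"
    using exists_power_of_prime_order[OF x p] none by blast
  then show ?thesis
    using p prime_imp_coprime coprime_commute by blast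
qed

lemma fermat_prime_power:
  fixes k q j :: nat
  assumes "prime q"
  shows "[k ^ (q ^ j) = k] (mod q)"
proof (induction j)
  case (Suc j)
  have step: "[m ^ q = m] (mod q)" for m :: nat
  proof (cases "q dvd m")
    case True
    then have "[m = 0] (mod q)" "[m ^ q = 0] (mod q)"
      using assms prime_gt_0_nat by (simp_all add: cong_0_iff dvd_power_iff dvd_trans[OF _ dvd_power])
    then show ?thesis
      by (meson cong_sym cong_trans)
  next
    case False
    have "[m * m ^ (q - 1) = m * 1] (mod q)"
      using fermat_theorem[OF assms False] by (rule cong_scalar_left)
    then show ?thesis
      using prime_gt_0_nat[OF assms] by (simp add: power_eq_if)
  qed
  have "[(k ^ q ^ j) ^ q = k ^ q] (mod q)"
    using Suc.IH by (rule cong_pow)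
  then have "[k ^ q ^ Suc j = k ^ q] (mod q)"
    by (simp add: power_mult[symmetric] mult.commute)
  then show ?case
    using step cong_trans by blast
qed simp

text \<open>In this situation \<open>B\<close> is a \<open>p\<close>-group while the orders of the elements of \<open>A\<close> involve both primes.
  The elements \<open>z\<close> and \<open>y\<close> serve as centres: \<open>A\<close> centralizes \<open>z\<close> and \<open>B\<close> centralizes \<open>y\<close>.\<close>

locale two_prime_product = claw_free_direct_product +
  fixes p q :: nat and w y z :: 'a
  assumes p: "prime p" and q: "prime q" and p_neq_q: "p \<noteq> q"
    and primes_A: "\<And>a. a \<in> A \<Longrightarrow> prime (ord a) \<Longrightarrow> ord a = p \<or> ord a = q"
    and primes_B: "\<And>b. b \<in> B \<Longrightarrow> prime (ord b) \<Longrightarrow> ord b = p"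
    and w: "w \<in> A" "ord w = p"
    and y: "y \<in> A" "ord y = q"
    and z: "z \<in> B" "ord z = p"
begin

lemma coprime_pq: "coprime p q"
  using p q p_neq_q primes_coprime by blast

lemma y_carrier: "y \<in> carrier G" and z_carrier: "z \<in> carrier G"
  using y z A_carrier B_carrier by blast+

lemma nontrivial_if_ord_prime:
  assumes "x \<in> carrier G" "prime (ord x)"
  shows "x \<noteq> \<one>"
  using assms ord_eq_1[of x] by fastforce

lemma y_nontrivial: "y \<noteq> \<one>" and z_nontrivial: "z \<noteq> \<one>"
  using nontrivial_if_ord_prime y_carrier z_carrier y z p q by simp_all

lemma coprime_ord_B:
  assumes "b \<in> B"
  shows "coprime (ord b) q"
proof (rule coprime_ord_if_no_prime_power_element[OF B_carrier[OF assms] q])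
  fix n :: nat
  show "ord (b [^] n) \<noteq> q"
    using primes_B[OF B_pow[OF assms, of n]] q p_neq_q by metis
qed

lemma cyclic_B: "\<exists>b \<in> B. B = generate G {b}"
proof (rule coprime_centralizing_subgroup_cyclic[OF subgroup_B y_carrier y_nontrivial])
  fix b assume "b \<in> B"
  then show "y \<otimes> b = b \<otimes> y \<and> coprime (ord y) (ord b)"
    using commute y coprime_ord_B coprime_commute by metis
qed

text \<open>The element \<open>z\<close> already generates a subgroup of order \<open>p\<close> centralizing \<open>y\<close>, and there is only
  one.\<close>

lemma y_not_centralized:
  assumes "x \<in> A" "ord x = p"
  shows "x \<otimes> y \<noteq> y \<otimes> x"
proof
  assume xy: "x \<otimes> y = y \<otimes> x"
  have x_carrier: "x \<in> carrier G"
    using assms A_carrier by blast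
  have "x \<in> generate G {z}"
  proof (rule unique_coprime_prime_order_subgroup[OF y_carrier y_nontrivial _ p])
    show "coprime (ord y) p"
      using y coprime_pq coprime_commute by metis
    show "y \<otimes> z = z \<otimes> y"
      using commute y z by blast
  qed (use x_carrier assms xy z_carrier z in simp_all)
  then have "x \<in> B"
    using cyclic_subset_subgroup[OF subgroup_B z(1)] by blast
  then have "x = \<one>"
    using inter_trivial assms by blast
  then show False
    using nontrivial_if_ord_prime[OF x_carrier] assms p by simp
qed

lemma conj_y_in_cyclic:
  assumes "g \<in> A"
  shows "g \<otimes> y \<otimes> inv g \<in> generate G {y}"
  using prime_subgroup_normal_in_A[OF y(1) _ assms z(1) z_nontrivial] y z q coprime_pq by simp

subsection \<open>The centralizer of the element of order q\<close>

definition Q where "Q = {x \<in> A. x \<otimes> y = y \<otimes> x}"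

lemma Q_in_A: "u \<in> Q \<Longrightarrow> u \<in> A"
  by (simp add: Q_def)

lemma Q_carrier: "u \<in> Q \<Longrightarrow> u \<in> carrier G"
  using Q_in_A A_carrier by blast

lemma y_in_Q: "y \<in> Q"
  using y by (simp add: Q_def)

lemma subgroup_Q: "subgroup Q G"
proof (rule subgroupI)
  show "Q \<subseteq> carrier G"
    using Q_carrier by blast
  show "Q \<noteq> {}"
    using y_in_Q by blast
next
  fix u assume u: "u \<in> Q"
  then have "inv u \<otimes> y = y \<otimes> inv u"
    using Q_carrier y_carrier unfolding Q_def
    by (metis (mono_tags, lifting) inv_closed inv_solve_left inv_solve_right m_assoc m_closed mem_Collect_eq)
  then show "inv u \<in> Q"
    using u subgroup.m_inv_closed[OF subgroup_A] by (simp add: Q_def)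
next
  fix u v assume uv: "u \<in> Q" "v \<in> Q"
  then have "u \<otimes> v \<otimes> y = y \<otimes> (u \<otimes> v)"
    using Q_carrier y_carrier unfolding Q_def
    by (metis (mono_tags, lifting) m_assoc mem_Collect_eq A_carrier)
  then show "u \<otimes> v \<in> Q"
    using uv subgroup.m_closed[OF subgroup_A] by (simp add: Q_def)
qed

lemma Q_pow: "u \<in> Q \<Longrightarrow> u [^] (n::nat) \<in> Q"
  using subgroup.one_closed[OF subgroup_Q] subgroup.m_closed[OF subgroup_Q] by (induction n) auto

text \<open>Since \<open>y\<close> is centralized by no element of \<open>A\<close> of order \<open>p\<close>, its centralizer in \<open>A\<close> is a
  \<open>q\<close>-group, and it is cyclic because it centralizes \<open>z\<close>.\<close>

lemma coprime_ord_Q: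
  assumes "u \<in> Q"
  shows "coprime (ord u) p"
proof (rule coprime_ord_if_no_prime_power_element[OF Q_carrier[OF assms] p])
  fix n :: nat
  show "ord (u [^] n) \<noteq> p"
    using y_not_centralized[of "u [^] n"] Q_pow[OF assms, of n] by (auto simp: Q_def)
qed

lemma cyclic_Q: "\<exists>u \<in> Q. Q = generate G {u}"
proof (rule coprime_centralizing_subgroup_cyclic[OF subgroup_Q z_carrier z_nontrivial])
  fix u assume "u \<in> Q"
  then show "z \<otimes> u = u \<otimes> z \<and> coprime (ord z) (ord u)"
    using commute[OF Q_in_A z(1)] z coprime_ord_Q coprime_commute by metis
qed

lemma card_Q: "\<exists>n. card Q = q ^ n"
proof -
  obtain u where u: "u \<in> Q" "Q = generate G {u}"
    using cyclic_Q by blast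
  have "r = q" if r: "prime r" "r dvd ord u" for r
  proof -
    obtain n :: nat where n: "ord (u [^] n) = r"
      using exists_power_of_prime_order[OF Q_carrier[OF u(1)] r] by blast
    then have "r = p \<or> r = q"
      using primes_A[OF Q_in_A[OF Q_pow[OF u(1), of n]]] r by simp
    moreover have "coprime r p"
      using coprime_ord_Q[OF Q_pow[OF u(1), of n]] n by simp
    ultimately show ?thesis
      using p by auto
  qed
  then have "\<exists>n. ord u = q ^ n"
    using nat_prime_power_if_unique_prime_divisor ord_ge_1[OF finite_carrier Q_carrier[OF u(1)]]
    by (metis less_le_trans zero_less_one)
  then show ?thesis
    using u generate_pow_card[OF Q_carrier[OF u(1)]] by metis
qed

text \<open>\<open>Q\<close> is also the centralizer of the subgroup generated by \<open>y\<close>, which is normal in \<open>A\<close>.\<close>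

lemma Q_conj_closed:
  assumes g: "g \<in> A" and u: "u \<in> Q"
  shows "g \<otimes> u \<otimes> inv g \<in> Q"
proof -
  have carrier: "g \<in> carrier G" "u \<in> carrier G"
    using g u A_carrier Q_carrier by blast+
  have "inv g \<in> A"
    using g subgroup.m_inv_closed[OF subgroup_A] by blast
  then obtain n :: nat where n: "inv g \<otimes> y \<otimes> g = y [^] n"
    using conj_y_in_cyclic[of "inv g"] in_cyclic_iff[OF y_carrier] carrier by auto
  have "u \<otimes> y [^] n = y [^] n \<otimes> u"
    using u y_carrier carrier group_commutes_pow[of y u n] by (simp add: Q_def)
  then have "g \<otimes> (u \<otimes> (inv g \<otimes> y \<otimes> g)) \<otimes> inv g = g \<otimes> ((inv g \<otimes> y \<otimes> g) \<otimes> u) \<otimes> inv g"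
    by (simp add: n)
  then have "g \<otimes> u \<otimes> inv g \<otimes> y = y \<otimes> (g \<otimes> u \<otimes> inv g)"
    using carrier y_carrier by (simp add: m_assoc inv_mult_cancel)
  moreover have "g \<otimes> u \<otimes> inv g \<in> A"
    using conj_in_A carrier Q_in_A[OF u] by blast
  ultimately show ?thesis
    by (simp add: Q_def)
qed

subsection \<open>The action on the subgroup of order q\<close>

text \<open>The action of \<open>A\<close> on the subgroup of order \<open>q\<close> generated by \<open>y\<close> embeds \<open>A\<close> modulo \<open>Q\<close> into the
  group of units modulo \<open>q\<close>. The exponents are natural numbers, determined up to congruence.\<close>

definition acts_as :: "'a \<Rightarrow> nat \<Rightarrow> bool" where
  "acts_as g k \<longleftrightarrow> g \<otimes> y \<otimes> inv g = y [^] k"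

lemma exists_acts_as:
  assumes "g \<in> A"
  shows "\<exists>k. acts_as g k"
  using conj_y_in_cyclic[OF assms] in_cyclic_iff[OF y_carrier] by (auto simp: acts_as_def)

lemma acts_as_cong:
  assumes "acts_as g k"
  shows "acts_as g l \<longleftrightarrow> [k = l] (mod q)"
  using assms pow_eq_iff_cong[OF y_carrier] y by (simp add: acts_as_def)

lemma acts_as_mult:
  assumes "g \<in> A" "h \<in> A" "acts_as g k" "acts_as h l"
  shows "acts_as (g \<otimes> h) (k * l)"
proof -
  have carrier: "g \<in> carrier G" "h \<in> carrier G"
    using assms A_carrier by blast+
  have "g \<otimes> h \<otimes> y \<otimes> inv (g \<otimes> h) = g \<otimes> (h \<otimes> y \<otimes> inv h) \<otimes> inv g"
    using carrier y_carrier by (simp add: inv_mult_group m_assoc)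
  also have "\<dots> = (g \<otimes> y \<otimes> inv g) [^] l"
    using assms(4) conj_pow[OF carrier(1) y_carrier] by (simp add: acts_as_def)
  also have "\<dots> = y [^] (k * l)"
    using assms y_carrier by (simp add: acts_as_def nat_pow_pow)
  finally show ?thesis
    by (simp add: acts_as_def)
qed

lemma acts_as_one: "acts_as \<one> 1"
  using y_carrier by (simp add: acts_as_def)

lemma acts_as_pow:
  assumes "g \<in> A" "acts_as g k"
  shows "acts_as (g [^] n) (k ^ n)"
proof (induction n)
  case 0
  then show ?case
    using acts_as_one by simp
next
  case (Suc n)
  then show ?case
    using acts_as_mult[OF A_pow[OF assms(1), of n] assms(1) Suc.IH assms(2)]
    by (simp add: mult.commute)
qed

lemma acts_as_not_dvd:
  assumes "g \<in> A" "acts_as g k"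
  shows "\<not> q dvd k"
proof
  assume "q dvd k"
  then have "y [^] k = \<one>"
    using y y_carrier pow_eq_id by simp
  then have "g \<otimes> y \<otimes> inv g = \<one>"
    using assms by (simp add: acts_as_def)
  then show False
    using conj_eq_one_iff[OF A_carrier[OF assms(1)] y_carrier] y_nontrivial by blast
qed

lemma acts_as_one_iff:
  assumes "g \<in> A"
  shows "acts_as g 1 \<longleftrightarrow> g \<in> Q"
  using assms conj_eq_iff_commute[OF A_carrier[OF assms] y_carrier] y_carrier
  by (simp add: acts_as_def Q_def)

text \<open>By Fermat, taking a \<open>q ^ j\<close>-th power does not change the action; for suitable \<open>j\<close> it removes the
  \<open>q\<close>-part of the element.\<close>

lemma exists_q'_element_with_same_action:
  assumes "g \<in> A" "acts_as g k"
  shows "\<exists>g' \<in> A. acts_as g' k \<and> coprime (ord g') q"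
proof -
  have g_carrier: "g \<in> carrier G"
    using assms A_carrier by blast
  have "ord g \<noteq> 0"
    using ord_ge_1[OF finite_carrier g_carrier] by simp
  then obtain m j where m: "ord g = q ^ j * m" "\<not> q dvd m"
    using multiplicity_decompose'[of "ord g" q] q by (metis not_prime_unit)
  have "ord (g [^] (q ^ j)) = m"
    using ord_pow[OF g_carrier, of "q ^ j"] m q prime_gt_0_nat by simp
  then have "coprime (ord (g [^] (q ^ j))) q"
    using m q prime_imp_coprime coprime_commute by blast
  moreover have "acts_as (g [^] (q ^ j)) k"
    using acts_as_pow[OF assms, of "q ^ j"] acts_as_cong fermat_prime_power[OF q] by blast
  ultimately show ?thesis
    using A_pow[OF assms(1)] by blast
qed

text \<open>The exponents of a primitive root modulo \<open>q\<close> that occur in the action of \<open>A\<close> are the multiples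
  of the least positive one, and an element acting by that one generates \<open>A\<close> modulo \<open>Q\<close>.\<close>

lemma exists_generator_modulo_Q:
  "\<exists>g \<in> A. coprime (ord g) q \<and> (\<forall>x \<in> A. \<exists>c \<in> Q. \<exists>t::nat. x = c \<otimes> g [^] t)"
proof -
  obtain h where "h \<in> {1..q - 1}" "{1..q - 1} = {h ^ i mod q | i. i \<in> UNIV}"
    using residue_prime_mult_group_has_gen[OF q] by blast
  then have root: "\<exists>i. k = h ^ i mod q" if "k \<in> {1..q - 1}" for k
    using that by auto
  have h: "\<not> q dvd h"
    using \<open>h \<in> {1..q - 1}\<close> by (auto dest: dvd_imp_le)
  have exponent: "\<exists>i. acts_as x (h ^ i)" if x: "x \<in> A" for x
  proof -
    obtain k where k: "acts_as x k"
      using exists_acts_as x by blast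
    have "k mod q \<noteq> 0"
      using acts_as_not_dvd[OF x k] by (simp add: dvd_eq_mod_eq_0)
    moreover have "k mod q < q"
      using prime_gt_0_nat[OF q] by simp
    ultimately have "k mod q \<in> {1..q - 1}"
      by simp
    then obtain i where "k mod q = h ^ i mod q"
      using root by blast
    then have "acts_as x (h ^ i)"
      using acts_as_cong[OF k] by (simp add: cong_def)
    then show ?thesis by blast
  qed
  define E where "E i \<longleftrightarrow> i > 0 \<and> (\<exists>x \<in> A. acts_as x (h ^ i))" for i
  have "E (q - 1)"
  proof -
    have "[1 = h ^ (q - 1)] (mod q)"
      using fermat_theorem[OF q h] cong_sym by blast
    then have "acts_as \<one> (h ^ (q - 1))"
      using acts_as_cong[OF acts_as_one] by blast
    then show ?thesis
      using subgroup.one_closed[OF subgroup_A] prime_gt_1_nat[OF q] by (auto simp: E_def)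
  qed
  define d where "d = (LEAST i. E i)"
  have "E d"
    unfolding d_def using \<open>E (q - 1)\<close> by (rule LeastI)
  then obtain g where g: "g \<in> A" "acts_as g (h ^ d)" "coprime (ord g) q" and d: "d > 0"
    using exists_q'_element_with_same_action unfolding E_def by blast
  have g_carrier: "g \<in> carrier G"
    using g A_carrier by blast
  have "\<exists>c \<in> Q. \<exists>t::nat. x = c \<otimes> g [^] t" if x: "x \<in> A" for x
  proof -
    obtain i where i: "acts_as x (h ^ i)"
      using exponent x by blast
    define t where "t = i div d"
    define c where "c = x \<otimes> inv (g [^] t)"
    have x_eq: "x = c \<otimes> g [^] t"
      using A_carrier[OF x] g_carrier by (simp add: c_def m_assoc)
    have c: "c \<in> A"
      unfolding c_def using x A_pow[OF g(1)] subgroup.m_closed[OF subgroup_A]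
        subgroup.m_inv_closed[OF subgroup_A] by blast
    obtain k where k: "acts_as c k"
      using exists_acts_as c by blast
    have "acts_as x (k * (h ^ d) ^ t)"
      unfolding x_eq using acts_as_mult[OF c A_pow[OF g(1)] k acts_as_pow[OF g(1,2)]] .
    then have "[k * (h ^ d) ^ t = h ^ i] (mod q)"
      using acts_as_cong i by blast
    moreover have "h ^ i = h ^ (i mod d) * (h ^ d) ^ t"
      unfolding t_def by (simp add: power_mult[symmetric] power_add[symmetric])
    moreover have "coprime ((h ^ d) ^ t) q"
    proof -
      have "coprime h q"
        using h q prime_imp_coprime coprime_commute by blast
      then show ?thesis by simp
    qed
    ultimately have "[k = h ^ (i mod d)] (mod q)"
      using cong_mult_rcancel_nat by metis
    then have c_acts: "acts_as c (h ^ (i mod d))"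
      using acts_as_cong[OF k] by blast
    have "\<not> E (i mod d)"
      using not_less_Least[of "i mod d" E] d by (simp add: d_def)
    then have "i mod d = 0"
      using c c_acts by (auto simp: E_def)
    then have "c \<in> Q"
      using c c_acts acts_as_one_iff by simp
    then show ?thesis
      using x_eq by blast
  qed
  then show ?thesis
    using g by blast
qed

end

section \<open>Bounds for the orders of the prime power parts\<close>

context two_prime_product
begin

text \<open>Since \<open>w\<close> does not commute with \<open>y\<close>, there are two different elements of \<open>A\<close> of order \<open>p\<close>. If
  \<open>b [^] p\<close> were nontrivial, multiplying \<open>b\<close> by each of them and by \<open>y\<close> would give three
  incomparable cyclic subgroups containing it.\<close>

lemma generator_of_B_has_prime_order:
  assumes b: "b \<in> B" "B = generate G {b}"
  shows "ord b = p"
proof -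
  have b_carrier: "b \<in> carrier G" and w_carrier: "w \<in> carrier G"
    using b w A_carrier B_carrier by blast+
  have p_dvd: "p dvd ord b"
    using ord_dvd_of_in_cyclic[of z b] z b b_carrier by simp
  define w' where "w' = y \<otimes> w \<otimes> inv y"
  have w': "w' \<in> A" "ord w' = p" "w' \<noteq> w"
  proof -
    show "w' \<in> A"
      unfolding w'_def using conj_in_A[OF y_carrier w(1)] .
    show "ord w' = p"
      unfolding w'_def using ord_conj[OF y_carrier w_carrier] w by simp
    show "w' \<noteq> w"
      unfolding w'_def using conj_eq_iff_commute[OF y_carrier w_carrier] y_not_centralized[OF w] by metis
  qed
  have key: "\<exists>n. x = x' [^] n \<and> [n = 1] (mod p)"
    if x: "x \<in> A" "x' \<in> A" "x \<otimes> b \<in> generate G {x' \<otimes> b}" for x x'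
  proof -
    obtain n :: nat where n: "x = x' [^] n" "b = b [^] n"
      using in_cyclic_coordinates[OF x(1) b(1) x(2) b(1) x(3)] by blast
    then have "b [^] n = b [^] (1::nat)"
      using b_carrier by simp
    then have "[n = 1] (mod ord b)"
      using pow_eq_iff_cong[OF b_carrier] by blast
    then show ?thesis
      using n(1) p_dvd cong_dvd_modulus_nat by blast
  qed
  have same: "x = x'"
    if x: "x \<in> A" "x' \<in> A" "ord x' = p" "x \<otimes> b \<in> generate G {x' \<otimes> b}" for x x'
  proof -
    obtain n :: nat where n: "x = x' [^] n" "[n = 1] (mod p)"
      using key[OF x(1,2,4)] by blast
    from n(2) have "x' [^] n = x' [^] (1::nat)"
      unfolding pow_eq_iff_cong[OF A_carrier[OF x(2)]] x(3) .
    then show ?thesis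
      using n(1) A_carrier[OF x(2)] by simp
  qed
  have dvd: "ord x dvd ord x'"
    if x: "x \<in> A" "x' \<in> A" "x \<otimes> b \<in> generate G {x' \<otimes> b}" for x x'
  proof -
    obtain n :: nat where "x = x' [^] n"
      using key[OF x] by blast
    then have "x \<in> generate G {x'}"
      using pow_in_cyclic[OF A_carrier[OF x(2)]] by simp
    then show ?thesis
      using ord_dvd_of_in_cyclic A_carrier[OF x(2)] by blast
  qed
  have not_dvd: "\<not> p dvd q" "\<not> q dvd p"
    using p q p_neq_q primes_dvd_imp_eq by metis+
  have above: "b [^] p \<in> generate G {x \<otimes> b}" if x: "x \<in> A" "ord x = p" for x
  proof -
    have x_carrier: "x \<in> carrier G"
      using x A_carrier by blast
    have "(x \<otimes> b) [^] p = x [^] p \<otimes> b [^] p"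
      using pow_mult_distrib[OF commute[OF x(1) b(1)] x_carrier b_carrier] .
    also have "x [^] p = \<one>"
      using pow_ord_eq_1[OF x_carrier] x by simp
    finally have "b [^] p = (x \<otimes> b) [^] p"
      using b_carrier by simp
    then show ?thesis
      using pow_in_cyclic[of "x \<otimes> b" p] x_carrier b_carrier by simp
  qed
  have above_y: "b [^] p \<in> generate G {y \<otimes> b}"
  proof -
    have "b \<in> generate G {b \<otimes> y}"
      using coprime_part_in_cyclic[OF b_carrier y_carrier] commute[OF y(1) b(1)]
        coprime_ord_B[OF b(1)] y(2) by simp
    then have "b \<in> generate G {y \<otimes> b}"
      using commute[OF y(1) b(1)] by simp
    then show ?thesis
      using in_cyclic_trans[OF pow_in_cyclic[OF b_carrier]] y_carrier b_carrier by blast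
  qed
  have "b [^] p = \<one>"
  proof (rule ccontr)
    assume "b [^] p \<noteq> \<one>"
    then have "w \<otimes> b \<in> generate G {w' \<otimes> b} \<or> w' \<otimes> b \<in> generate G {w \<otimes> b} \<or>
      w \<otimes> b \<in> generate G {y \<otimes> b} \<or> y \<otimes> b \<in> generate G {w \<otimes> b} \<or>
      w' \<otimes> b \<in> generate G {y \<otimes> b} \<or> y \<otimes> b \<in> generate G {w' \<otimes> b}"
      using no_three_above[OF _ _ _ _ above[OF w] above[OF w'(1,2)] above_y]
        w_carrier y_carrier b_carrier A_carrier[OF w'(1)] by blast
    then show False
    proof (elim disjE)
      assume "w \<otimes> b \<in> generate G {w' \<otimes> b}"
      then show False
        using same[OF w(1) w'(1,2)] w'(3) by blast
    next
      assume "w' \<otimes> b \<in> generate G {w \<otimes> b}"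
      then show False
        using same[OF w'(1) w] w'(3) by blast
    next
      assume "w \<otimes> b \<in> generate G {y \<otimes> b}"
      then show False
        using dvd[OF w(1) y(1)] w y not_dvd by simp
    next
      assume "y \<otimes> b \<in> generate G {w \<otimes> b}"
      then show False
        using dvd[OF y(1) w(1)] w y not_dvd by simp
    next
      assume "w' \<otimes> b \<in> generate G {y \<otimes> b}"
      then show False
        using dvd[OF w'(1) y(1)] w' y not_dvd by simp
    next
      assume "y \<otimes> b \<in> generate G {w' \<otimes> b}"
      then show False
        using dvd[OF y(1) w'(1)] w' y not_dvd by simp
    qed
  qed
  moreover have "b \<noteq> \<one>"
  proof
    assume "b = \<one>"
    then show False
      using p_dvd p by simp
  qed
  ultimately show ?thesis
    using ord_eq_prime[OF p b_carrier] by blast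
qed

text \<open>An exponent that fixes the \<open>A\<close>-coordinate is \<open>1\<close> modulo \<open>p\<close> and so fixes the \<open>B\<close>-coordinate.\<close>

lemma z_power_coordinate:
  assumes g: "g \<in> A" "p dvd ord g" and mem: "g \<otimes> z [^] i \<in> generate G {g \<otimes> z [^] j}"
  shows "[i = j] (mod p)"
proof -
  have g_carrier: "g \<in> carrier G"
    using g A_carrier by blast
  obtain n :: nat where n: "g = g [^] n" "z [^] i = (z [^] j) [^] n"
    using in_cyclic_coordinates[OF g(1) B_pow[OF z(1)] g(1) B_pow[OF z(1)] mem] by blast
  then have "g [^] n = g [^] (1::nat)"
    using g_carrier by simp
  then have "[n = 1] (mod ord g)"
    using pow_eq_iff_cong[OF g_carrier] by blast
  then have "[n = 1] (mod p)"
    using g(2) cong_dvd_modulus_nat by blast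
  then have "[j * n = j * 1] (mod p)"
    by (rule cong_scalar_left)
  moreover have "[i = j * n] (mod p)"
    using n(2) pow_eq_iff_cong[OF z_carrier] z z_carrier by (simp add: nat_pow_pow)
  ultimately show ?thesis
    using cong_trans by simp
qed

lemma pow_times_z:
  assumes "g \<in> A" "p dvd n"
  shows "(g \<otimes> z [^] (i::nat)) [^] n = g [^] n"
proof -
  have "(g \<otimes> z [^] i) [^] n = g [^] n \<otimes> (z [^] i) [^] n"
    using pow_mult_distrib[OF commute[OF assms(1) B_pow[OF z(1)]]] A_carrier[OF assms(1)] z_carrier by simp
  also have "(z [^] i) [^] n = \<one>"
    using assms(2) z z_carrier by (simp add: nat_pow_pow pow_eq_id)
  finally show ?thesis
    using A_carrier[OF assms(1)] by simp
qed

text \<open>For large \<open>a\<close> there are three incomparable cyclic subgroups above a power of \<open>g\<close>: if \<open>p \<ge> 3\<close>, the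
  elements \<open>g\<close>, \<open>g \<otimes> z\<close>, \<open>g \<otimes> z [^] 2\<close> have the same \<open>p\<close>-th power. For \<open>p = 2\<close> there are only two
  such elements, and \<open>g [^] 2 \<otimes> z\<close> lies with them above \<open>g [^] 4\<close>, which is nontrivial once
  \<open>a \<ge> 3\<close>.\<close>

lemma p_power_order_bound:
  assumes g: "g \<in> A" "ord g = p ^ a"
  shows "a \<le> 1 \<or> p = 2 \<and> a = 2"
proof (rule ccontr)
  assume contra: "\<not> ?thesis"
  have g_carrier: "g \<in> carrier G"
    using g A_carrier by blast
  have p1: "p > 1"
    using p prime_gt_1_nat by blast
  have p_dvd: "p dvd ord g"
    using g(2) contra by simp
  have carrier: "g \<otimes> z [^] i \<in> carrier G" for i :: nat
    using g_carrier z_carrier by simp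
  consider "p \<ge> 3" "a \<ge> 2" | "p = 2" "a \<ge> 3"
    using contra p1 by linarith
  then show False
  proof cases
    case 1
    have "\<not> p ^ a dvd p ^ 1"
      using 1 p1 power_dvd_imp_le by fastforce
    then have "g [^] p \<noteq> \<one>"
      using g pow_eq_id[OF g_carrier] by simp
    moreover have "g [^] p \<in> generate G {g \<otimes> z [^] i}" for i :: nat
      using pow_in_cyclic[OF carrier, of i p] pow_times_z[OF g(1), of p i] by simp
    ultimately have "\<exists>i j. i \<in> {0, 1, 2} \<and> j \<in> {0, 1, 2::nat} \<and> i \<noteq> j \<and>
        g \<otimes> z [^] i \<in> generate G {g \<otimes> z [^] j}"
      using no_three_above[OF _ carrier[of 0] carrier[of 1] carrier[of 2], of "g [^] p"]
      by (smt (verit) insertCI one_neq_zero zero_neq_numeral one_eq_numeral_iff semiring_norm(85))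
    then obtain i j :: nat where ij: "i \<in> {0, 1, 2}" "j \<in> {0, 1, 2}" "i \<noteq> j"
      "g \<otimes> z [^] i \<in> generate G {g \<otimes> z [^] j}"
      by blast
    then have "[i = j] (mod p)"
      using z_power_coordinate[OF g(1) p_dvd] by blast
    moreover have "i < p" "j < p"
      using ij 1 by auto
    ultimately show False
      using ij(3) by (simp add: cong_less_modulus_unique_nat)
  next
    case 2
    define v where "v = g [^] (2::nat) \<otimes> z"
    have v_carrier: "v \<in> carrier G"
      using g_carrier z_carrier by (simp add: v_def)
    have g2: "g [^] (2::nat) \<in> A"
      using A_pow g(1) by blast
    have four: "(4::nat) dvd ord g"
      using 2 g(2) le_imp_power_dvd[of 2 a "2::nat"] by simp
    have "\<not> (2::nat) ^ a dvd 2 ^ 2"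
      using 2 power_dvd_imp_le[of "2::nat" a 2] by auto
    then have "g [^] (4::nat) \<noteq> \<one>"
      using g 2 pow_eq_id[OF g_carrier] by simp
    moreover have "g [^] (4::nat) \<in> generate G {g \<otimes> z [^] i}" for i :: nat
      using pow_in_cyclic[OF carrier, of i 4] pow_times_z[OF g(1), of 4 i] 2 by simp
    moreover have "g [^] (4::nat) \<in> generate G {v}"
      using pow_in_cyclic[OF v_carrier, of 2] pow_times_z[OF g2, of 2 1] 2 g_carrier z_carrier
      by (simp add: v_def nat_pow_pow)
    ultimately have "\<exists>i. i \<in> {0, 1::nat} \<and> (v \<in> generate G {g \<otimes> z [^] i} \<or> g \<otimes> z [^] i \<in> generate G {v}) \<or>
        g \<otimes> z [^] i \<in> generate G {g \<otimes> z [^] (1 - i)} \<and> i \<in> {0, 1}"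
      using no_three_above[OF _ carrier[of 0] carrier[of 1] v_carrier, of "g [^] (4::nat)"]
      by (metis diff_self_eq_0 diff_zero insertCI)
    then consider i :: nat where "i \<in> {0, 1}" "v \<in> generate G {g \<otimes> z [^] i}"
      | i :: nat where "g \<otimes> z [^] i \<in> generate G {v}"
      | i :: nat where "i \<in> {0, 1}" "g \<otimes> z [^] i \<in> generate G {g \<otimes> z [^] (1 - i)}"
      by blast
    then show False
    proof cases
      case (1 i)
      \<comment> \<open>the exponent is even because it maps \<open>g\<close> to its square, and thus kills the \<open>B\<close>-coordinate\<close>
      obtain n :: nat where n: "g [^] (2::nat) = g [^] n" "z = (z [^] i) [^] n"
        using in_cyclic_coordinates[OF g2 z(1) g(1) B_pow[OF z(1)]] 1(2) unfolding v_def by blast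
      then have "[2 = n] (mod ord g)"
        using pow_eq_iff_cong[OF g_carrier] by blast
      then have "[2 = n] (mod 2)"
        using four cong_dvd_modulus_nat[of 2 n "ord g" 2] by (metis dvd_trans dvd_triv_left numeral_Bit0_eq_double)
      then have "even n"
        by (simp add: cong_def dvd_eq_mod_eq_0)
      then have "(z [^] i) [^] n = \<one>"
        using z 2 z_carrier by (simp add: nat_pow_pow pow_eq_id)
      then show False
        using n(2) z_nontrivial by simp
    next
      case (2 i)
      obtain n :: nat where n: "g = (g [^] (2::nat)) [^] n"
        using in_cyclic_coordinates[OF g(1) B_pow[OF z(1)] g2 z(1)] 2 unfolding v_def by blast
      then have "g [^] (1::nat) = g [^] (2 * n)"
        using g_carrier by (simp add: nat_pow_pow)
      then have "[1 = 2 * n] (mod ord g)"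
        using pow_eq_iff_cong[OF g_carrier] by blast
      then have "[1 = 2 * n] (mod 2)"
        using four cong_dvd_modulus_nat[of 1 "2 * n" "ord g" 2] by (metis dvd_trans dvd_triv_left numeral_Bit0_eq_double)
      then show False
        by (simp add: cong_def)
    next
      case (3 i)
      then have "[i = 1 - i] (mod 2)"
        using z_power_coordinate[OF g(1) p_dvd 3(2)] \<open>p = 2\<close> by simp
      then show False
        using 3(1) by (auto simp: cong_def)
    qed
  qed
qed

end

section \<open>Cyclic groups\<close>

context group
begin

lemma cyclic_group_cyclic_subgroup:
  assumes "x \<in> carrier G"
  shows "cyclic_group (G\<lparr>carrier := generate G {x}\<rparr>)"
proof -
  have sub: "subgroup (generate G {x}) G"
    using assms generate_is_subgroup by simp
  interpret H: group "G\<lparr>carrier := generate G {x}\<rparr>"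
    using sub subgroup_imp_group by blast
  have x: "x \<in> generate G {x}"
    by (simp add: generate.incl)
  have "generate G {x} = range (\<lambda>n::int. x [^] n)"
    using generate_pow[OF assms] by auto
  then have "generate G {x} = range (\<lambda>n::int. x [^]\<^bsub>G\<lparr>carrier := generate G {x}\<rparr>\<^esub> n)"
    unfolding int_pow_consistent[OF sub x] .
  then show ?thesis
    using x unfolding H.cyclic_group partial_object.update_convs(1) by (intro bexI[of _ x]) simp_all
qed

lemma cyclic_subgroup_iso_integer_mod_group:
  assumes x: "x \<in> carrier G" and pos: "ord x > 0"
  shows "G\<lparr>carrier := generate G {x}\<rparr> \<cong> integer_mod_group (ord x)"
proof -
  have pow_mod: "x [^] (k mod int (ord x)) = x [^] k" for k :: int
    using int_pow_eq[OF x, of "k mod int (ord x)" k] by (simp add: minus_mod_eq_mult_div)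
  have carrier: "carrier (integer_mod_group (ord x)) = {0..<int (ord x)}"
    using pos by (simp add: carrier_integer_mod_group)
  have "(\<lambda>k. x [^] k) \<in> iso (integer_mod_group (ord x)) (G\<lparr>carrier := generate G {x}\<rparr>)"
  proof (rule isoI)
    show "(\<lambda>k. x [^] k) \<in> hom (integer_mod_group (ord x)) (G\<lparr>carrier := generate G {x}\<rparr>)"
      by (rule homI) (use x in \<open>auto simp: generate_pow pow_mod int_pow_mult\<close>)
    have "inj_on (\<lambda>k. x [^] k) {0..<int (ord x)}"
    proof (rule inj_onI)
      fix k l :: int
      assume kl: "k \<in> {0..<int (ord x)}" "l \<in> {0..<int (ord x)}" "x [^] k = x [^] l"
      then have "int (ord x) dvd l - k"
        using int_pow_eq[OF x] by blast
      then have "l mod int (ord x) = k mod int (ord x)"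
        by (simp add: mod_eq_dvd_iff)
      then show "k = l"
        using kl by simp
    qed
    moreover have "(\<lambda>k. x [^] k) ` {0..<int (ord x)} = generate G {x}"
    proof -
      have "x [^] k \<in> (\<lambda>k. x [^] k) ` {0..<int (ord x)}" for k :: int
        using pow_mod[of k] pos by (intro image_eqI[of _ _ "k mod int (ord x)"]) simp_all
      then show ?thesis
        using generate_pow[OF x] by auto
    qed
    ultimately show "bij_betw (\<lambda>k. x [^] k) (carrier (integer_mod_group (ord x)))
        (carrier (G\<lparr>carrier := generate G {x}\<rparr>))"
      using carrier by (simp add: bij_betw_def)
  qed
  then show ?thesis
    using group.iso_sym[OF group_integer_mod_group] is_isoI by blast
qed

end

section \<open>The structure of the group\<close>

text \<open>The element \<open>g\<close> that generates \<open>A\<close> modulo \<open>Q\<close> can be taken of order prime to \<open>q\<close>, so that its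
  cyclic group \<open>L\<close> is a complement of \<open>Q\<close>. It acts faithfully on \<open>Q\<close> because an element of \<open>L\<close>
  centralizing \<open>Q\<close> centralizes \<open>y\<close> and thus lies in \<open>Q\<close>.\<close>

theorem (in two_prime_product) decomposition:
  "\<exists>P. internal_direct_product G B A \<and>
     G\<lparr>carrier := B\<rparr> \<cong> integer_mod_group p \<and>
     Q \<lhd> G\<lparr>carrier := A\<rparr> \<and>
     cyclic_group (G\<lparr>carrier := Q\<rparr>) \<and> is_p_group q (G\<lparr>carrier := Q\<rparr>) \<and>
     subgroup P (AutoGroup (G\<lparr>carrier := Q\<rparr>)) \<and>
     cyclic_group (AutoGroup (G\<lparr>carrier := Q\<rparr>)\<lparr>carrier := P\<rparr>) \<and>
     is_p_group p (AutoGroup (G\<lparr>carrier := Q\<rparr>)\<lparr>carrier := P\<rparr>) \<and>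
     G\<lparr>carrier := A\<rparr> \<cong> semidirect_product (G\<lparr>carrier := Q\<rparr>) P \<and>
     (AutoGroup (G\<lparr>carrier := Q\<rparr>)\<lparr>carrier := P\<rparr> \<cong> integer_mod_group p \<or>
      p = 2 \<and> AutoGroup (G\<lparr>carrier := Q\<rparr>)\<lparr>carrier := P\<rparr> \<cong> integer_mod_group 4)"
proof -
  obtain b where b: "b \<in> B" "B = generate G {b}"
    using cyclic_B by blast
  have iso_B: "G\<lparr>carrier := B\<rparr> \<cong> integer_mod_group p"
    using cyclic_subgroup_iso_integer_mod_group[OF B_carrier[OF b(1)]]
      generator_of_B_has_prime_order[OF b] prime_gt_0_nat[OF p] b(2) by simp
  obtain u where u: "u \<in> Q" "Q = generate G {u}"
    using cyclic_Q by blast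
  have cyclic: "cyclic_group (G\<lparr>carrier := Q\<rparr>)"
    using cyclic_group_cyclic_subgroup[OF Q_carrier[OF u(1)]] u(2) by simp
  have q_group: "is_p_group q (G\<lparr>carrier := Q\<rparr>)"
    using card_Q subgroup_imp_group[OF subgroup_Q] by (simp add: is_p_group_def order_def)
  interpret A: group "G\<lparr>carrier := A\<rparr>"
    using subgroup_A subgroup_imp_group by blast
  have Q_sub: "subgroup Q (G\<lparr>carrier := A\<rparr>)"
    using subgroup_incl[OF subgroup_Q subgroup_A] Q_in_A by blast
  then have Q_normal: "Q \<lhd> G\<lparr>carrier := A\<rparr>"
    using A.normal_inv_iff Q_conj_closed m_inv_consistent[OF subgroup_A] by simp
  obtain g where g: "g \<in> A" "coprime (ord g) q"
    and generated: "\<And>x. x \<in> A \<Longrightarrow> \<exists>c \<in> Q. \<exists>t::nat. x = c \<otimes> g [^] t"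
    using exists_generator_modulo_Q by blast
  have g_carrier: "g \<in> carrier G"
    using g A_carrier by blast
  have ord_g_pos: "ord g > 0"
    using ord_ge_1[OF finite_carrier g_carrier] by simp
  have "r = p" if r: "prime r" "r dvd ord g" for r
  proof -
    obtain n :: nat where n: "ord (g [^] n) = r"
      using exists_power_of_prime_order[OF g_carrier r] by blast
    have "r \<noteq> q"
      using g(2) r q by auto
    then show ?thesis
      using primes_A[OF A_pow[OF g(1), of n]] n r by auto
  qed
  then obtain a where a: "ord g = p ^ a"
    using nat_prime_power_if_unique_prime_divisor[OF ord_g_pos] by blast
  define L where "L = generate G {g}"
  have L_sub: "subgroup L G"
    using g_carrier generate_is_subgroup by (simp add: L_def)
  have L_in_A: "L \<subseteq> A"
    using cyclic_subset_subgroup[OF subgroup_A g(1)] by (simp add: L_def)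
  have inter: "x = \<one>" if x: "x \<in> Q" "x \<in> L" for x
  proof -
    have "ord x dvd p ^ a"
      using ord_dvd_of_in_cyclic[OF _ g_carrier] x(2) a by (simp add: L_def)
    moreover have "coprime (ord x) (p ^ a)"
      using coprime_ord_Q[OF x(1)] by simp
    ultimately have "ord x = 1"
      by (metis coprime_absorb_left nat_dvd_1_iff_1)
    then show ?thesis
      using ord_eq_1[OF Q_carrier[OF x(1)]] by simp
  qed
  have "a \<noteq> 0"
  proof
    assume "a = 0"
    then have "g = \<one>"
      using a ord_eq_1[OF g_carrier] by simp
    then have "w \<in> Q"
      using generated[OF w(1)] Q_carrier by auto
    then show False
      using y_not_centralized[OF w] by (simp add: Q_def)
  qed
  then have a_cases: "a = 1 \<or> p = 2 \<and> a = 2"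
    using p_power_order_bound[OF g(1) a] by linarith
  have "\<exists>P. subgroup P (AutoGroup (G\<lparr>carrier := A, carrier := Q\<rparr>)) \<and>
      G\<lparr>carrier := A, carrier := L\<rparr> \<cong> AutoGroup (G\<lparr>carrier := A, carrier := Q\<rparr>)\<lparr>carrier := P\<rparr> \<and>
      G\<lparr>carrier := A\<rparr> \<cong> semidirect_product (G\<lparr>carrier := A, carrier := Q\<rparr>) P"
  proof (rule A.faithful_complement_imp_semidirect_product[OF Q_normal])
    show "subgroup L (G\<lparr>carrier := A\<rparr>)"
      using subgroup_incl[OF L_sub subgroup_A L_in_A] .
    have "\<one> \<in> Q \<inter> L"
      using subgroup.one_closed[OF subgroup_Q] subgroup.one_closed[OF L_sub] by blast
    then show "Q \<inter> L = {\<one>\<^bsub>G\<lparr>carrier := A\<rparr>\<^esub>}"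
      using inter by (simp add: set_eq_iff) blast
    have "Q <#> L \<subseteq> A"
      using Q_in_A L_in_A subgroup.m_closed[OF subgroup_A] unfolding set_mult_def by blast
    moreover have "A \<subseteq> Q <#> L"
      using generated pow_in_cyclic[OF g_carrier] unfolding set_mult_def L_def by blast
    ultimately show "Q <#>\<^bsub>G\<lparr>carrier := A\<rparr>\<^esub> L = carrier (G\<lparr>carrier := A\<rparr>)"
      by simp
    fix x assume x: "x \<in> L"
      and centralizes: "\<And>c. c \<in> Q \<Longrightarrow> x \<otimes>\<^bsub>G\<lparr>carrier := A\<rparr>\<^esub> c = c \<otimes>\<^bsub>G\<lparr>carrier := A\<rparr>\<^esub> x"
    have "x \<in> Q"
      using x L_in_A centralizes[OF y_in_Q] by (auto simp: Q_def)
    then show "x = \<one>\<^bsub>G\<lparr>carrier := A\<rparr>\<^esub>"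
      using inter x by simp
  qed
  then obtain P where P: "subgroup P (AutoGroup (G\<lparr>carrier := Q\<rparr>))"
    and iso_P: "G\<lparr>carrier := L\<rparr> \<cong> AutoGroup (G\<lparr>carrier := Q\<rparr>)\<lparr>carrier := P\<rparr>"
    and iso_A: "G\<lparr>carrier := A\<rparr> \<cong> semidirect_product (G\<lparr>carrier := Q\<rparr>) P"
    by auto
  have group_L: "group (G\<lparr>carrier := L\<rparr>)"
    using L_sub subgroup_imp_group by blast
  have group_P: "group (AutoGroup (G\<lparr>carrier := Q\<rparr>)\<lparr>carrier := P\<rparr>)"
    using group.subgroup_imp_group[OF group.AutoGroup P] subgroup_imp_group[OF subgroup_Q] by blast
  have "cyclic_group (AutoGroup (G\<lparr>carrier := Q\<rparr>)\<lparr>carrier := P\<rparr>)"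
    using isomorphic_group_cyclicity[OF iso_P group_L group_P]
      cyclic_group_cyclic_subgroup[OF g_carrier] by (simp add: L_def)
  moreover have "is_p_group p (AutoGroup (G\<lparr>carrier := Q\<rparr>)\<lparr>carrier := P\<rparr>)"
    using group_P iso_same_card[OF iso_P] generate_pow_card[OF g_carrier] a
    by (auto simp: is_p_group_def order_def L_def intro!: exI[of _ a])
  moreover have "AutoGroup (G\<lparr>carrier := Q\<rparr>)\<lparr>carrier := P\<rparr> \<cong> integer_mod_group (p ^ a)"
    using iso_trans[OF group.iso_sym[OF group_L iso_P]]
      cyclic_subgroup_iso_integer_mod_group[OF g_carrier ord_g_pos] a by (simp add: L_def)
  then have "AutoGroup (G\<lparr>carrier := Q\<rparr>)\<lparr>carrier := P\<rparr> \<cong> integer_mod_group p \<or>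
      p = 2 \<and> AutoGroup (G\<lparr>carrier := Q\<rparr>)\<lparr>carrier := P\<rparr> \<cong> integer_mod_group 4"
    using a_cases by auto
  ultimately show ?thesis
    using internal_direct_product_sym[OF direct_product] iso_B Q_normal cyclic q_group P iso_A
    by blast
qed

section \<open>Distribution of the primes over the factors\<close>

context claw_free_direct_product
begin

lemma exists_prime_order_element:
  assumes "A \<noteq> {\<one>}"
  shows "\<exists>x \<in> A. prime (ord x)"
proof -
  obtain a where a: "a \<in> A" "a \<noteq> \<one>"
    using assms subgroup.one_closed[OF subgroup_A] by blast
  then have a_carrier: "a \<in> carrier G"
    using A_carrier by blast
  then have "ord a \<noteq> 1"
    using a ord_eq_1 by blast
  then obtain r where r: "prime r" "r dvd ord a"
    using prime_factor_nat by blast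
  then obtain n :: nat where "ord (a [^] n) = r"
    using exists_power_of_prime_order[OF a_carrier] by blast
  then show ?thesis
    using A_pow[OF a(1), of n] r by metis
qed

lemma cyclic_A_if_coprime:
  assumes v: "v \<in> B" "prime (ord v)" and none: "\<And>x. x \<in> A \<Longrightarrow> ord x \<noteq> ord v"
  shows "\<exists>a \<in> A. A = generate G {a}"
proof (rule coprime_centralizing_subgroup_cyclic[OF subgroup_A B_carrier[OF v(1)]])
  show "v \<noteq> \<one>"
    using v(2) by auto
  fix a assume a: "a \<in> A"
  have "coprime (ord a) (ord v)"
    using coprime_ord_if_no_prime_power_element[OF A_carrier[OF a] v(2)] none[OF A_pow[OF a]] by blast
  then show "v \<otimes> a = a \<otimes> v \<and> coprime (ord v) (ord a)"
    using commute[OF a v(1)] by (simp add: coprime_commute)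
qed

lemma abelian_if_cyclic_factors:
  assumes a: "a \<in> A" "A = generate G {a}" and b: "b \<in> B" "B = generate G {b}"
    and xy: "x \<in> carrier G" "y \<in> carrier G"
  shows "x \<otimes> y = y \<otimes> x"
proof -
  have carrier: "a \<in> carrier G" "b \<in> carrier G"
    using a b A_carrier B_carrier by blast+
  have form: "\<exists>(m::nat) (n::nat). g = a [^] m \<otimes> b [^] n" if g: "g \<in> carrier G" for g
  proof -
    obtain c d where "c \<in> A" "d \<in> B" "g = c \<otimes> d"
      using decompose[OF g] by blast
    moreover from this(1) obtain m :: nat where "c = a [^] m"
      using a(2) in_cyclic_iff[OF carrier(1)] by blast
    moreover from calculation(2) obtain n :: nat where "d = b [^] n"
      using b(2) in_cyclic_iff[OF carrier(2)] by blast
    ultimately show ?thesis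
      by (intro exI[of _ m] exI[of _ n]) simp
  qed
  obtain m n m' n' :: nat where x: "x = a [^] m \<otimes> b [^] n" and y: "y = a [^] m' \<otimes> b [^] n'"
    using form[OF xy(1)] form[OF xy(2)] by blast
  have swap: "b [^] i \<otimes> a [^] j = a [^] j \<otimes> b [^] i" for i j :: nat
    using commute[OF A_pow[OF a(1)] B_pow[OF b(1)]] by simp
  have "a [^] i \<otimes> b [^] j \<otimes> (a [^] k \<otimes> b [^] l) = a [^] (i + k) \<otimes> b [^] (j + l)" for i j k l :: nat
  proof -
    have "a [^] i \<otimes> b [^] j \<otimes> (a [^] k \<otimes> b [^] l) = a [^] i \<otimes> (b [^] j \<otimes> a [^] k) \<otimes> b [^] l"
      using carrier by (simp add: m_assoc)
    also have "\<dots> = (a [^] i \<otimes> a [^] k) \<otimes> (b [^] j \<otimes> b [^] l)"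
      unfolding swap using carrier by (simp add: m_assoc)
    finally show ?thesis
      using carrier by (simp add: nat_pow_mult)
  qed
  then show ?thesis
    unfolding x y by (simp add: add.commute)
qed

text \<open>Every element of prime order has a coordinate of the same order, so the group has prime power
  order.\<close>

lemma nilpotent_if_one_prime:
  assumes "prime r" and one_prime: "\<And>x. x \<in> A \<union> B \<Longrightarrow> prime (ord x) \<Longrightarrow> ord x = r"
  shows "nilpotent_group G"
proof -
  have "ord x = r" if x: "x \<in> carrier G" "prime (ord x)" for x
  proof -
    obtain a b where ab: "a \<in> A" "b \<in> B" "x = a \<otimes> b"
      using decompose x by blast
    have carrier: "a \<in> carrier G" "b \<in> carrier G"
      using ab A_carrier B_carrier by blast+
    have "a [^] ord x \<otimes> b [^] ord x = \<one> \<otimes> \<one>"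
      using pow_ord_eq_1[OF x(1)] pow_mult_distrib[OF commute[OF ab(1,2)] carrier] ab(3) by simp
    then have "a [^] ord x = \<one>" "b [^] ord x = \<one>"
      using coordinates_unique[OF A_pow[OF ab(1)] B_pow[OF ab(2)]
        subgroup.one_closed[OF subgroup_A] subgroup.one_closed[OF subgroup_B]] by simp_all
    moreover have "a \<noteq> \<one> \<or> b \<noteq> \<one>"
      using x ab(3) by auto
    ultimately have "ord a = ord x \<or> ord b = ord x"
      using ord_eq_prime[OF x(2)] carrier by blast
    then show ?thesis
      using one_prime ab x by (metis UnCI)
  qed
  then obtain k where "order G = r ^ k"
    using order_prime_power by blast
  then show ?thesis
    using prime_power_order_imp_nilpotent assms by blast
qed

lemma third_prime_impossible:
  assumes x: "x \<in> A" "prime (ord x)" and v: "v \<in> B" "prime (ord v)" and "ord x \<noteq> ord v"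
    and a: "a \<in> A" "prime (ord a)"
  shows "ord a = ord x \<or> ord a = ord v"
  using no_third_prime[OF x a v] assms(5) by metis

lemma two_prime_productI:
  assumes x: "x \<in> A" "prime (ord x)" and v: "v \<in> B" "prime (ord v)" and neq: "ord x \<noteq> ord v"
    and w: "w \<in> A" "ord w = ord v"
  shows "two_prime_product G A B (ord v) (ord x) w x v"
proof unfold_locales
  interpret swapped: claw_free_direct_product G B A
    using swapped .
  show "ord a = ord v \<or> ord a = ord x" if "a \<in> A" "prime (ord a)" for a
    using third_prime_impossible[OF x v neq that] by blast
  show "ord b = ord v" if b: "b \<in> B" "prime (ord b)" for b
    using swapped.third_prime_impossible[OF v x neq[symmetric] b]
      not_both_primes_in_both_factors[OF w x(1) refl v(1) refl b(1) _ v(2) x(2) neq[symmetric]] by blast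
qed (use assms in simp_all)

text \<open>Unless a single prime occurs, there are distinct primes occurring in different factors. If neither
  of them occurs in both, the two factors have coprime orders, so each is cyclic and the group is
  abelian. Otherwise exactly one prime occurs twice, and the factor in which the other one occurs
  takes the part of \<open>A\<close>.\<close>

lemma two_prime_product_cases:
  assumes nontrivial: "A \<noteq> {\<one>}" "B \<noteq> {\<one>}" and not_nilpotent: "\<not> nilpotent_group G"
  shows "\<exists>p q w x v. two_prime_product G A B p q w x v \<or> two_prime_product G B A p q w x v"
proof -
  interpret swapped: claw_free_direct_product G B A
    using swapped .
  obtain x0 v0 where x0: "x0 \<in> A" "prime (ord x0)" and v0: "v0 \<in> B" "prime (ord v0)"
    using exists_prime_order_element swapped.exists_prime_order_element nontrivial by blast
  have "\<exists>x \<in> A. \<exists>v \<in> B. prime (ord x) \<and> prime (ord v) \<and> ord x \<noteq> ord v"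
  proof (rule ccontr)
    assume "\<not> ?thesis"
    then have eq: "ord x = ord v" if "x \<in> A" "v \<in> B" "prime (ord x)" "prime (ord v)" for x v
      using that by blast
    have "ord x = ord x0" if "x \<in> A \<union> B" "prime (ord x)" for x
      using that eq[OF _ v0(1) _ v0(2), of x] eq[OF x0(1) v0(1) x0(2) v0(2)] eq[OF x0(1) _ x0(2), of x]
      by auto
    then show False
      using nilpotent_if_one_prime[OF x0(2)] not_nilpotent by blast
  qed
  then obtain x v where x: "x \<in> A" "prime (ord x)" and v: "v \<in> B" "prime (ord v)"
    and neq: "ord x \<noteq> ord v"
    by blast
  have "(\<exists>w \<in> A. ord w = ord v) \<or> (\<exists>w \<in> B. ord w = ord x)"
  proof (rule ccontr)
    assume none: "\<not> ?thesis"
    obtain a where a: "a \<in> A" "A = generate G {a}"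
      using cyclic_A_if_coprime[OF v] none by blast
    obtain b where b: "b \<in> B" "B = generate G {b}"
      using swapped.cyclic_A_if_coprime[OF x] none by blast
    show False
      using abelian_imp_nilpotent[OF abelian_if_cyclic_factors[OF a b]] not_nilpotent by blast
  qed
  then show ?thesis
    using two_prime_productI[OF x v neq] swapped.two_prime_productI[OF v x neq[symmetric]] by blast
qed

end

theorem theorem2p13:
  fixes G :: "('a, 'b) monoid_scheme"
  assumes "group G" and "finite (carrier G)" and "\<not> nilpotent_group G"
    and "\<exists>A B. internal_direct_product G A B \<and> A \<noteq> {\<one>\<^bsub>G\<^esub>} \<and> B \<noteq> {\<one>\<^bsub>G\<^esub>}"
    and "claw_free (reduced_power_graph G)"
  shows "\<exists>(p::nat) (q::nat) H K Q P.
           prime p \<and> prime q \<and> p \<noteq> q \<and>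
           internal_direct_product G H K \<and>
           G\<lparr>carrier := H\<rparr> \<cong> integer_mod_group p \<and>
           Q \<lhd> G\<lparr>carrier := K\<rparr> \<and>
           cyclic_group (G\<lparr>carrier := Q\<rparr>) \<and> is_p_group q (G\<lparr>carrier := Q\<rparr>) \<and>
           subgroup P (AutoGroup (G\<lparr>carrier := Q\<rparr>)) \<and>
           cyclic_group (AutoGroup (G\<lparr>carrier := Q\<rparr>)\<lparr>carrier := P\<rparr>) \<and>
           is_p_group p (AutoGroup (G\<lparr>carrier := Q\<rparr>)\<lparr>carrier := P\<rparr>) \<and>
           G\<lparr>carrier := K\<rparr> \<cong> semidirect_product (G\<lparr>carrier := Q\<rparr>) P \<and>
           (AutoGroup (G\<lparr>carrier := Q\<rparr>)\<lparr>carrier := P\<rparr> \<cong> integer_mod_group p \<or>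
            p = 2 \<and> AutoGroup (G\<lparr>carrier := Q\<rparr>)\<lparr>carrier := P\<rparr> \<cong> integer_mod_group 4)"
proof -
  obtain A B where AB: "internal_direct_product G A B" "A \<noteq> {\<one>\<^bsub>G\<^esub>}" "B \<noteq> {\<one>\<^bsub>G\<^esub>}"
    using assms(4) by blast
  interpret claw_free_direct_product G A B
    using assms(1,2,5) AB(1)
    by (simp add: claw_free_direct_product_def claw_free_direct_product_axioms_def
        claw_free_group_def claw_free_group_axioms_def finite_group_def finite_group_axioms_def)
  obtain p q w x v A' B' where "two_prime_product G A' B' p q w x v"
    using two_prime_product_cases[OF AB(2,3) assms(3)] by blast
  then interpret two_prime_product G A' B' p q w x v .
  show ?thesis
    using decomposition p q p_neq_q by blast
qed

end
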